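(* For $X \to \infty$ we have $$X^{2s-1} \ll N_s(X) \le X^{2s-1+o(1)}.$$ That is, there is an absolute constant $c_0 > 0$ such that for every integer $s \ge 1$ and every $\varepsilon > 0$, for all sufficiently large real $X$ (in terms of $s$ and $\varepsilon$) we have $c_0 X^{2s-1} \le N_s(X) \le X^{2s-1+\varepsilon}$.
   Context: For $A = \begin{bmatrix} a & b \\ c & d \end{bmatrix} \in \mathrm{SL}_2(\mathbb{Z})$ put $\|A\| = \max\{|a|,|b|,|c|,|d|\}$, and for $X > 0$ let $\mathrm{SL}_2(\mathbb{Z};X) = \{A \in \mathrm{SL}_2(\mathbb{Z}) : \|A\| \le X\}$. An $s$-tuple $(A_1,\ldots,A_s)$ of matrices in $\mathrm{SL}_2(\mathbb{Z})$ is called free if $A_1,\ldots,A_s$ are free generators of a free subgroup of $\mathrm{SL}_2(\mathbb{Z})$ (of rank $s$), and non-free otherwise. Equivalently, it is non-free if there exist $m \ge 1$, indices $\nu_1,\ldots,\nu_m \in \{1,\ldots,s\}$ and signs $e_1,\ldots,e_m \in \{1,-1\}$, such that there is no $i \in \{1,\ldots,m-1\}$ with $\nu_i = \nu_{i+1}$ and $e_i = -e_{i+1}$, and $A_{\nu_1}^{e_1} \cdots A_{\nu_m}^{e_m} = I_2$, where $I_2$ is the identity matrix. $N_s(X)$ denotes the number of non-free $s$-tuples $(A_1,\ldots,A_s) \in \mathrm{SL}_2(\mathbb{Z};X)^s$. The paper's convention is that constants implied by $\ll$ are absolute. *)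

theory Defs
  imports "HOL-Analysis.Determinants" "HOL-Algebra.Group"
begin

section \<open>Free tuples in a group\<close>

text \<open>
  A word is a list of letters \<open>(\<nu>, e)\<close>, where \<open>\<nu>\<close> is a generator index (counted from 0) and
  \<open>e \<in> {1, -1}\<close> a sign.
\<close>

definition words :: "nat \<Rightarrow> (nat \<times> int) list set"
  where "words s = lists ({..<s} \<times> {1, -1})"

definition reduced :: "(nat \<times> int) list \<Rightarrow> bool"
  where "reduced w \<longleftrightarrow>
    \<not> (\<exists>i. Suc i < length w \<and> fst (w ! i) = fst (w ! Suc i) \<and> snd (w ! i) = - snd (w ! Suc i))"

definition word_value :: "('a, 'b) monoid_scheme \<Rightarrow> 'a list \<Rightarrow> (nat \<times> int) list \<Rightarrow> 'a"
  where "word_value G As w = foldr (\<lambda>(\<nu>, e) g. (As ! \<nu>) [^]\<^bsub>G\<^esub> e \<otimes>\<^bsub>G\<^esub> g) w \<one>\<^bsub>G\<^esub>"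

text \<open>
  The entries of \<open>As\<close> freely generate a free subgroup of rank \<open>length As\<close>. In particular the
  entries are then pairwise distinct; the empty tuple is free.
\<close>

definition free_tuple :: "('a, 'b) monoid_scheme \<Rightarrow> 'a list \<Rightarrow> bool"
  where "free_tuple G As \<longleftrightarrow>
    (\<forall>w \<in> words (length As). w \<noteq> [] \<and> reduced w \<longrightarrow> word_value G As w \<noteq> \<one>\<^bsub>G\<^esub>)"

section \<open>The modular group\<close>

definition SL2Z :: "(int ^ 2 ^ 2) monoid"
  where "SL2Z = \<lparr>carrier = {A. det A = 1}, mult = (**), one = mat 1\<rparr>"

lemma SL2Z_group: "group SL2Z"
proof (rule groupI)
  fix A assume "A \<in> carrier SL2Z"
  then have d: "A $ 1 $ 1 * A $ 2 $ 2 - A $ 1 $ 2 * A $ 2 $ 1 = 1"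
    by (simp add: SL2Z_def det_2)
  define B :: "int ^ 2 ^ 2" where
    "B = vector [vector [A $ 2 $ 2, - A $ 1 $ 2], vector [- A $ 2 $ 1, A $ 1 $ 1]]"
  have "det B = 1"
    using d by (simp add: B_def det_2 vector_2 algebra_simps)
  moreover have "B ** A = mat 1"
    using d by (simp add: B_def vec_eq_iff forall_2 matrix_matrix_mult_def mat_def sum_2 vector_2
        algebra_simps)
  ultimately show "\<exists>B \<in> carrier SL2Z. B \<otimes>\<^bsub>SL2Z\<^esub> A = \<one>\<^bsub>SL2Z\<^esub>"
    by (auto simp: SL2Z_def)
qed (auto simp: SL2Z_def det_mul matrix_mul_assoc)

definition height :: "int ^ 2 ^ 2 \<Rightarrow> int"
  where "height A = Max {\<bar>A $ i $ j\<bar> | i j. True}"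

lemma ex_2: "(\<exists>i::2. P i) \<longleftrightarrow> P 1 \<or> P 2"
  by (metis exhaust_2)

lemma height_eq: "height A = Max {\<bar>A $ 1 $ 1\<bar>, \<bar>A $ 1 $ 2\<bar>, \<bar>A $ 2 $ 1\<bar>, \<bar>A $ 2 $ 2\<bar>}"
proof -
  have "{\<bar>A $ i $ j\<bar> | i j. True} = {\<bar>A $ 1 $ 1\<bar>, \<bar>A $ 1 $ 2\<bar>, \<bar>A $ 2 $ 1\<bar>, \<bar>A $ 2 $ 2\<bar>}"
    by (auto simp: set_eq_iff ex_2)
  then show ?thesis by (simp only: height_def)
qed

definition SL2Z_ball :: "real \<Rightarrow> (int ^ 2 ^ 2) set"
  where "SL2Z_ball X = {A \<in> carrier SL2Z. real_of_int (height A) \<le> X}"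

definition nonfree_tuples :: "nat \<Rightarrow> real \<Rightarrow> (int ^ 2 ^ 2) list set"
  where "nonfree_tuples s X =
    {As. length As = s \<and> set As \<subseteq> SL2Z_ball X \<and> \<not> free_tuple SL2Z As}"

lemma finite_SL2Z_ball: "finite (SL2Z_ball X)"
proof -
  let ?I = "{- \<lfloor>X\<rfloor>..\<lfloor>X\<rfloor>}"
  let ?f = "\<lambda>(a, b, c, d). vector [vector [a, b], vector [c, d]] :: int ^ 2 ^ 2"
  have "A \<in> ?f ` (?I \<times> ?I \<times> ?I \<times> ?I)" if "A \<in> SL2Z_ball X" for A
  proof
    have "height A \<le> \<lfloor>X\<rfloor>" using that by (simp add: SL2Z_ball_def le_floor_iff)
    then show "(A $ 1 $ 1, A $ 1 $ 2, A $ 2 $ 1, A $ 2 $ 2) \<in> ?I \<times> ?I \<times> ?I \<times> ?I"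
      by (auto simp: height_eq)
    show "A = ?f (A $ 1 $ 1, A $ 1 $ 2, A $ 2 $ 1, A $ 2 $ 2)"
      by (simp add: vec_eq_iff forall_2)
  qed
  then have "SL2Z_ball X \<subseteq> ?f ` (?I \<times> ?I \<times> ?I \<times> ?I)" by blast
  then show ?thesis by (rule finite_subset) simp
qed

lemma finite_nonfree_tuples: "finite (nonfree_tuples s X)"
  by (rule finite_subset[OF _ finite_lists_length_eq[OF finite_SL2Z_ball[of X], of s]])
    (auto simp: nonfree_tuples_def)

definition N_nonfree :: "nat \<Rightarrow> real \<Rightarrow> nat"
  where "N_nonfree s X = card (nonfree_tuples s X)"

end

theory Submission
  imports Defs "HOL-Computational_Algebra.Primes" "HOL-Number_Theory.Cong"
begin

text \<open>
  Upper bound: a matrix \<open>A\<close> of norm \<open>N\<close> maps every vector outside an angle of order \<open>1/N\<close> around the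
  largest column of \<open>A\<inverse>\<close> into an angle of order \<open>1/N\<close> around its own largest column. By ping-pong on
  \<open>\<int>\<^sup>2\<close>, a tuple is free as soon as the \<open>2s\<close> largest columns of its entries and their inverses point in
  sufficiently different directions. Otherwise either one entry has bounded trace, which leaves
  \<open>X\<^bsup>1+o(1)\<^esup>\<close> choices for it, or two entries have nearly parallel columns \<open>p\<close>, \<open>v\<close> with
  \<open>\<bar>p \<and> v\<bar> \<le> 4 X\<close>, which leaves \<open>X\<^bsup>3+o(1)\<^esup>\<close> choices for this pair. All counts reduce to the divisor
  bound, by fixing all but two of the unknowns, whose product is then known.

  Lower bound: take the first entry to be a conjugate \<open>g J g\<inverse>\<close> of the rotation of order 4, where \<open>g\<close>
  has norm at most \<open>(X/2)\<^bsup>1/2\<^esup>\<close>, and the others arbitrary. The constant is absolute because the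
  ball of radius \<open>X\<close> has at least \<open>X\<^sup>2\<close> elements.
\<close>

section \<open>Ping-pong\<close>

definition vheight :: "int ^ 2 \<Rightarrow> int"
  where "vheight v = max \<bar>v $ 1\<bar> \<bar>v $ 2\<bar>"

definition wedge :: "int ^ 2 \<Rightarrow> int ^ 2 \<Rightarrow> int"
  where "wedge u v = u $ 1 * v $ 2 - u $ 2 * v $ 1"

text \<open>On determinant 1 this is the inverse, in a form with explicit entries.\<close>

definition adj2 :: "int ^ 2 ^ 2 \<Rightarrow> int ^ 2 ^ 2"
  where "adj2 A = vector [vector [A $ 2 $ 2, - A $ 1 $ 2], vector [- A $ 2 $ 1, A $ 1 $ 1]]"

lemma adj2_nth [simp]:
  "adj2 A $ 1 $ 1 = A $ 2 $ 2" "adj2 A $ 1 $ 2 = - A $ 1 $ 2"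
  "adj2 A $ 2 $ 1 = - A $ 2 $ 1" "adj2 A $ 2 $ 2 = A $ 1 $ 1"
  by (simp_all add: adj2_def)

lemma vec2_eq_iff: "(u :: 'a ^ 2) = v \<longleftrightarrow> u $ 1 = v $ 1 \<and> u $ 2 = v $ 2"
  by (simp add: vec_eq_iff forall_2)

lemma adj2_adj2 [simp]: "adj2 (adj2 A) = A"
  by (simp add: vec2_eq_iff)

lemma det_adj2 [simp]: "det (adj2 A) = det A"
  by (simp add: det_2 algebra_simps)

lemma height_adj2 [simp]: "height (adj2 A) = height A"
  by (simp add: height_eq insert_commute)

lemma height_eq_max: "height A = max (vheight (column 1 A)) (vheight (column 2 A))"
  by (simp add: height_eq vheight_def column_def max.assoc max.left_commute)

lemma abs_entry_le_height: "\<bar>A $ i $ j\<bar> \<le> height A"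
  using exhaust_2[of i] exhaust_2[of j] unfolding height_eq by (elim disjE) (simp_all add: le_max_iff_disj)

lemma wedge_commute: "wedge u v = - wedge v u"
  by (simp add: wedge_def)

lemma vheight_nonneg [simp]: "0 \<le> vheight v"
  by (simp add: vheight_def)

text \<open>Planar vectors satisfy \<open>wedge p q\<close> v = \<open>wedge p v\<close> q -
  \<open>wedge q v\<close> p. This acts as a triangle inequality for directions: a vector nearly
  parallel to both \<open>p\<close> and \<open>q\<close> forces these two to be nearly
  parallel.\<close>

lemma vheight_wedge_le:
  "vheight v * \<bar>wedge p q\<bar> \<le> vheight p * \<bar>wedge q v\<bar> + vheight q * \<bar>wedge p v\<bar>"
proof -
  have *: "\<bar>v $ i\<bar> * \<bar>wedge p q\<bar> \<le> vheight p * \<bar>wedge q v\<bar> + vheight q * \<bar>wedge p v\<bar>" for i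
  proof -
    have i: "i = 1 \<or> i = 2" by (rule exhaust_2)
    have "v $ i * wedge p q = q $ i * wedge p v - p $ i * wedge q v"
      using i by (auto simp: wedge_def algebra_simps)
    then have "\<bar>v $ i\<bar> * \<bar>wedge p q\<bar> \<le> \<bar>q $ i\<bar> * \<bar>wedge p v\<bar> + \<bar>p $ i\<bar> * \<bar>wedge q v\<bar>"
      by (metis abs_mult abs_triangle_ineq4)
    also have "\<dots> \<le> vheight q * \<bar>wedge p v\<bar> + vheight p * \<bar>wedge q v\<bar>"
      using i by (intro add_mono mult_right_mono) (auto simp: vheight_def)
    finally show ?thesis by simp
  qed
  show ?thesis using *[of 1] *[of 2] unfolding vheight_def[of v] by (auto simp: max_def)
qed

text \<open>The wedge of A e_k and A v equals det A times the wedge of e_k and v, which is a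
  coordinate of \<open>v\<close> up to sign.\<close>

lemma wedge_column_mult:
  assumes "det A = 1"
  shows "\<bar>wedge (column k A) (A *v v)\<bar> \<le> vheight v"
proof -
  have d: "A $ 1 $ 1 * A $ 2 $ 2 - A $ 1 $ 2 * A $ 2 $ 1 = 1"
    using assms by (simp add: det_2)
  have "wedge (column 1 A) (A *v v) = (A $ 1 $ 1 * A $ 2 $ 2 - A $ 1 $ 2 * A $ 2 $ 1) * v $ 2"
    "wedge (column 2 A) (A *v v) = - (A $ 1 $ 1 * A $ 2 $ 2 - A $ 1 $ 2 * A $ 2 $ 1) * v $ 1"
    by (simp_all add: wedge_def column_def matrix_vector_mult_def sum_2 algebra_simps)
  then show ?thesis using d exhaust_2[of k] by (auto simp: vheight_def)
qed

text \<open>The columns of \<open>adj2 A\<close> are, up to sign, the rows of \<open>A\<close>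
  turned by a right angle, so the wedge is a coordinate of \<open>A *v v\<close> up to sign. A
  vector away from such a column is therefore stretched by \<open>A\<close>.\<close>

lemma wedge_column_adj2:
  "\<bar>wedge (column k (adj2 A)) v\<bar> \<le> vheight (A *v v)"
  using exhaust_2[of k]
  by (auto simp: wedge_def column_def matrix_vector_mult_def sum_2 vheight_def algebra_simps)

text \<open>The direction into which \<open>A\<close> contracts everything away from the direction \<open>att (adj2 A)\<close>.\<close>

definition att :: "int ^ 2 ^ 2 \<Rightarrow> int ^ 2"
  where "att A = (if vheight (column 1 A) = height A then column 1 A else column 2 A)"

lemma vheight_att [simp]: "vheight (att A) = height A"
  by (auto simp: att_def height_eq_max)

lemma att_column_cases:
  "att A = column 1 A \<and> vheight (column 1 A) = height A \<or>
   att A = column 2 A \<and> vheight (column 2 A) = height A"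
  using vheight_att[of A] by (auto simp: att_def)

lemma att_cases: "\<exists>k. att A = column k A"
  by (auto simp: att_def)

lemma height_pos:
  assumes "det A = 1"
  shows "1 \<le> height A"
proof (rule ccontr)
  assume "\<not> 1 \<le> height A"
  then have "A $ 1 $ 1 = 0" "A $ 1 $ 2 = 0" unfolding height_eq by (simp_all, linarith+)
  with assms show False by (simp add: det_2)
qed

text \<open>Here \<open>p\<close> stands for the attracting direction of the letter applied just
  before, and its cone consists of the \<open>v\<close> with
  \<open>\<bar>wedge p v\<bar> \<le> vheight v\<close>. If \<open>v\<close> were also close to the
  repelling direction \<open>att (adj2 A)\<close>, then \<open>vheight_wedge_le\<close> would
  contradict \<open>far\<close>. Hence \<open>A\<close> at least doubles \<open>v\<close> and moves
  it into the cone of \<open>att A\<close>.\<close>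

lemma ping_pong_step:
  assumes A: "det A = 1" and v: "0 < vheight v" "\<bar>wedge p v\<bar> \<le> vheight v"
    and far: "2 * (vheight p + height A) < \<bar>wedge p (att (adj2 A))\<bar>"
  shows "2 * vheight v \<le> vheight (A *v v)"
    and "\<bar>wedge (att A) (A *v v)\<bar> \<le> vheight (A *v v)"
proof -
  let ?q = "att (adj2 A)"
  have "2 * vheight v \<le> \<bar>wedge ?q v\<bar>"
  proof (rule ccontr)
    assume "\<not> 2 * vheight v \<le> \<bar>wedge ?q v\<bar>"
    then have "vheight p * \<bar>wedge ?q v\<bar> + vheight ?q * \<bar>wedge p v\<bar>
        \<le> vheight p * (2 * vheight v) + vheight ?q * vheight v"
      using v by (intro add_mono mult_left_mono vheight_nonneg) auto
    then have "vheight v * \<bar>wedge p ?q\<bar> \<le> vheight v * (2 * vheight p + height A)"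
      using vheight_wedge_le[of v p ?q] by (simp add: algebra_simps)
    then have "\<bar>wedge p ?q\<bar> \<le> 2 * vheight p + height A"
      using v(1) by simp
    then show False using far height_pos[OF A] by simp
  qed
  also have "\<dots> \<le> vheight (A *v v)"
    using att_cases[of "adj2 A"] wedge_column_adj2 by metis
  finally show *: "2 * vheight v \<le> vheight (A *v v)" .
  have "\<bar>wedge (att A) (A *v v)\<bar> \<le> vheight v"
    using att_cases[of A] wedge_column_mult[OF A] by metis
  then show "\<bar>wedge (att A) (A *v v)\<bar> \<le> vheight (A *v v)"
    using * v(1) by simp
qed

lemma SL2Z_inv:
  assumes "det A = 1"
  shows "inv\<^bsub>SL2Z\<^esub> A = adj2 A"
proof (rule group.inv_equality[OF SL2Z_group])
  show "adj2 A \<otimes>\<^bsub>SL2Z\<^esub> A = \<one>\<^bsub>SL2Z\<^esub>"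
    using assms by (simp add: SL2Z_def vec2_eq_iff matrix_matrix_mult_def mat_def sum_2 det_2
        algebra_simps)
qed (use assms in \<open>auto simp: SL2Z_def\<close>)

definition letter :: "(int ^ 2 ^ 2) list \<Rightarrow> nat \<times> int \<Rightarrow> int ^ 2 ^ 2"
  where "letter As x = (if snd x = 1 then As ! fst x else adj2 (As ! fst x))"

lemma word_value_Cons:
  assumes "set As \<subseteq> carrier SL2Z" "fst x < length As" "snd x \<in> {1, -1}"
  shows "word_value SL2Z As (x # w) = letter As x ** word_value SL2Z As w"
proof -
  have "det (As ! fst x) = 1" "As ! fst x \<in> carrier SL2Z"
    using assms(1,2) nth_mem by (fastforce simp: SL2Z_def)+
  then have "(As ! fst x) [^]\<^bsub>SL2Z\<^esub> (snd x) = letter As x"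
    using assms(3) SL2Z_group
    by (auto simp: letter_def SL2Z_inv group.int_pow_neg group.int_pow_1)
  then show ?thesis
    by (cases x) (simp add: word_value_def SL2Z_def)
qed

lemma reduced_Cons_Cons:
  "reduced (x # y # w) \<longleftrightarrow> \<not> (fst x = fst y \<and> snd x = - snd y) \<and> reduced (y # w)"
proof -
  have *: "(\<exists>i. P i) \<longleftrightarrow> P 0 \<or> (\<exists>i. P (Suc i))" for P :: "nat \<Rightarrow> bool"
    by (metis not0_implies_Suc)
  show ?thesis
    unfolding reduced_def de_Morgan_disj[symmetric] not_not
    by (rule arg_cong[where f = Not], rule trans[OF *]) simp
qed

text \<open>Reading a reduced word from right to left, every letter at least doubles the current
  vector and puts it into the cone of that letter. The value of the word thus moves the starting
  vector and is not the identity.\<close>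

lemma free_tuple_of_far:
  assumes As: "set As \<subseteq> carrier SL2Z"
    and far: "\<And>x y. x \<in> {..<length As} \<times> {1, -1} \<Longrightarrow> y \<in> {..<length As} \<times> {1, -1} \<Longrightarrow> x \<noteq> y \<Longrightarrow>
      2 * (height (letter As x) + height (letter As y))
        < \<bar>wedge (att (letter As x)) (att (letter As y))\<bar>"
  shows "free_tuple SL2Z As"
  unfolding free_tuple_def
proof (intro ballI impI notI)
  fix w assume w: "w \<in> words (length As)" "w \<noteq> [] \<and> reduced w"
    and one: "word_value SL2Z As w = \<one>\<^bsub>SL2Z\<^esub>"
  let ?S = "{..<length As} \<times> {1, -1 :: int}"
  \<comment> \<open>This vector lies in the cone of the last letter because its wedge with itself is
    0, so that letter can be treated as if it followed a copy of itself.\<close>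
  define v where "v = att (letter As (last w))"
  have det: "det (letter As x) = 1" if "x \<in> ?S" for x
    using that As nth_mem by (fastforce simp: letter_def SL2Z_def)
  have step: "2 * vheight u \<le> vheight (letter As x *v u)
      \<and> \<bar>wedge (att (letter As x)) (letter As x *v u)\<bar> \<le> vheight (letter As x *v u)"
    if x: "x \<in> ?S" and y: "y \<in> ?S" and ne: "\<not> (fst x = fst y \<and> snd x = - snd y)"
      and u: "0 < vheight u" "\<bar>wedge (att (letter As y)) u\<bar> \<le> vheight u" for x y u
  proof -
    \<comment> \<open>The repelling direction of \<open>x\<close> is the attracting direction of its
      inverse \<open>?z\<close>. Since \<open>x\<close> and \<open>y\<close> do not cancel,
      \<open>y\<close> differs from \<open>?z\<close> and \<open>far\<close> applies to the
      two.\<close>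
    let ?z = "(fst x, - snd x)"
    have z: "letter As ?z = adj2 (letter As x)" "?z \<in> ?S" "y \<noteq> ?z"
      using x ne by (auto simp: letter_def)
    show ?thesis
      using ping_pong_step[OF det[OF x] u] far[OF y z(2,3)] by (simp add: z(1) add.commute)
  qed
  have "2 * vheight v \<le> vheight (word_value SL2Z As w *v v) \<and>
      \<bar>wedge (att (letter As (hd w))) (word_value SL2Z As w *v v)\<bar>
        \<le> vheight (word_value SL2Z As w *v v)"
    and vpos: "0 < vheight v"
  proof -
    have "last w \<in> ?S" using w by (auto simp: words_def)
    then show pos: "0 < vheight v"
      using height_pos[OF det] by (force simp: v_def)
    show "2 * vheight v \<le> vheight (word_value SL2Z As w *v v) \<and>
        \<bar>wedge (att (letter As (hd w))) (word_value SL2Z As w *v v)\<bar>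
        \<le> vheight (word_value SL2Z As w *v v)"
      using w v_def
    proof (induction w)
      case (Cons x w)
      have x: "x \<in> ?S" "fst x < length As" "snd x \<in> {1, -1}"
        and w: "w \<in> words (length As)" using Cons.prems by (auto simp: words_def)
      note wv = word_value_Cons[OF As x(2,3)]
      show ?case
      proof (cases w)
        case Nil
        have "word_value SL2Z As [] = mat 1" by (simp add: word_value_def SL2Z_def)
        then show ?thesis
          using step[OF x(1) x(1) _ pos] x(3) Cons.prems pos
          by (auto simp: Nil wv wedge_def)
      next
        case (Cons y w')
        have y: "y \<in> ?S" using w Cons by (auto simp: words_def)
        have r: "\<not> (fst x = fst y \<and> snd x = - snd y)" "reduced w"
          using Cons.prems(2) Cons by (auto simp: reduced_Cons_Cons)
        let ?u = "word_value SL2Z As w *v v"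
        have u: "2 * vheight v \<le> vheight ?u" "\<bar>wedge (att (letter As y)) ?u\<bar> \<le> vheight ?u"
          using Cons.IH[OF w] r(2) Cons Cons.prems(3) by auto
        show ?thesis
          using step[OF x(1) y r(1), of ?u] u pos
          by (auto simp: wv matrix_vector_mul_assoc)
      qed
    qed simp
  qed
  then show False
    unfolding one using vpos by (simp add: SL2Z_def)
qed

section \<open>Small trace when the attracting and repelling directions are close\<close>

text \<open>Otherwise \<open>x\<close> and \<open>y\<close> both have absolute value
  \<open>N\<close>, and the difference of the products is at least N^2 - N (N - 2) = 2 N > 1. In the
  application \<open>w\<close> is the entry shared, up to sign, by the largest columns of a matrix
  and of its adjugate.\<close>

lemma large_entry:
  fixes x y z w N :: int
  assumes "\<bar>x * y - z * w\<bar> = 1" "1 \<le> N" "\<bar>z\<bar> \<le> N"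
    "max \<bar>x\<bar> \<bar>w\<bar> = N" "max \<bar>y\<bar> \<bar>w\<bar> = N"
  shows "N - 1 \<le> \<bar>w\<bar>"
proof (rule ccontr)
  assume w: "\<not> N - 1 \<le> \<bar>w\<bar>"
  then have "\<bar>x\<bar> = N" "\<bar>y\<bar> = N" using assms(4,5) by auto
  then have "\<bar>x * y\<bar> = N * N" by (simp add: abs_mult)
  moreover have "\<bar>z * w\<bar> \<le> N * (N - 2)"
    unfolding abs_mult using assms w by (intro mult_mono) auto
  ultimately show False using assms(1,2) by (simp add: algebra_simps)
qed

text \<open>For N at least 2 one has N \<le> 2 |m|, hence |m| |t| \<le> 4 N + 1 \<le> 9 |m|. For N =
  1 the last hypothesis suffices.\<close>

lemma small_factor:
  fixes m t e N :: int
  assumes "1 \<le> N" "N - 1 \<le> \<bar>m\<bar>" "\<bar>m * t + e\<bar> \<le> 4 * N" "\<bar>e\<bar> \<le> 1" "\<bar>t\<bar> \<le> 2 * N"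
  shows "\<bar>t\<bar> \<le> 9"
proof (cases "N = 1")
  case False
  then have m: "1 \<le> \<bar>m\<bar>" "N \<le> 2 * \<bar>m\<bar>" using assms by linarith+
  have "\<bar>m\<bar> * \<bar>t\<bar> \<le> 4 * N + 1" unfolding abs_mult[symmetric] using assms(3,4) by linarith
  also have "\<dots> \<le> \<bar>m\<bar> * 9" using m by linarith
  finally show ?thesis using m by (simp only: mult_le_cancel_left_pos)
qed (use assms in auto)

text \<open>Up to an error of 1, the wedge is the trace times an entry of absolute value at least
  \<open>height A - 1\<close>.\<close>

lemma trace_bound:
  assumes A: "det A = 1" and near: "\<bar>wedge (att A) (att (adj2 A))\<bar> \<le> 4 * height A"
  shows "\<bar>A $ 1 $ 1 + A $ 2 $ 2\<bar> \<le> 9"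
proof -
  define a b c d where abcd: "a = A $ 1 $ 1" "b = A $ 1 $ 2" "c = A $ 2 $ 1" "d = A $ 2 $ 2"
  define N where "N = height A"
  have det: "a * d - b * c = 1" using A by (simp add: det_2 abcd)
  have N: "1 \<le> N" "\<bar>a\<bar> \<le> N" "\<bar>b\<bar> \<le> N" "\<bar>c\<bar> \<le> N" "\<bar>d\<bar> \<le> N"
    using height_pos[OF A] by (simp_all add: N_def abcd abs_entry_le_height)
  have att: "att A = column 1 A \<and> max \<bar>a\<bar> \<bar>c\<bar> = N \<or> att A = column 2 A \<and> max \<bar>b\<bar> \<bar>d\<bar> = N"
    using att_column_cases[of A] by (simp add: vheight_def column_def N_def abcd)
  have att': "att (adj2 A) = column 1 (adj2 A) \<and> max \<bar>d\<bar> \<bar>c\<bar> = N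
      \<or> att (adj2 A) = column 2 (adj2 A) \<and> max \<bar>a\<bar> \<bar>b\<bar> = N"
    using att_column_cases[of "adj2 A"] by (simp add: vheight_def column_def N_def abcd max.commute)
  have near': "\<bar>wedge (att A) (att (adj2 A))\<bar> \<le> 4 * N" using near by (simp add: N_def)
  \<comment> \<open>The four cases say which column of \<open>A\<close> and which column of
    \<open>adj2 A\<close> is the largest. With equal column numbers the wedge is an exact multiple
    of the trace; with different ones, replacing \<open>b * c\<close> by \<open>a * d - 1\<close>
    leaves an error of 1 or -1.\<close>
  have "\<exists>m e. \<bar>e\<bar> \<le> 1 \<and> N - 1 \<le> \<bar>m\<bar> \<and> \<bar>m * (a + d) + e\<bar> \<le> 4 * N"
    using att att'
  proof (elim disjE conjE)
    assume h: "att A = column 1 A" "att (adj2 A) = column 1 (adj2 A)"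
      "max \<bar>a\<bar> \<bar>c\<bar> = N" "max \<bar>d\<bar> \<bar>c\<bar> = N"
    have "\<bar>a * d - b * c\<bar> = 1" using det by (simp add: algebra_simps)
    then have "N - 1 \<le> \<bar>c\<bar>"
      using h(3,4) by (intro large_entry[of a d b c, OF _ N(1) N(3)]) (simp_all only: max.commute)
    moreover have "wedge (att A) (att (adj2 A)) = - c * (a + d)"
      unfolding h by (simp add: wedge_def column_def abcd algebra_simps)
    ultimately show ?thesis using near' by (intro exI[of _ "- c"] exI[of _ 0]) simp
  next
    assume h: "att A = column 1 A" "att (adj2 A) = column 2 (adj2 A)"
      "max \<bar>a\<bar> \<bar>c\<bar> = N" "max \<bar>a\<bar> \<bar>b\<bar> = N"
    have "\<bar>c * b - d * a\<bar> = 1" using det by (simp add: algebra_simps)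
    then have "N - 1 \<le> \<bar>a\<bar>"
      using h(3,4) by (intro large_entry[of c b d a, OF _ N(1) N(5)]) (simp_all only: max.commute)
    moreover have "wedge (att A) (att (adj2 A)) = a * (a + d) + (- 1)"
      unfolding h using det by (simp add: wedge_def column_def abcd algebra_simps)
    ultimately show ?thesis using near' by (intro exI[of _ a] exI[of _ "- 1"]) simp
  next
    assume h: "att A = column 2 A" "att (adj2 A) = column 1 (adj2 A)"
      "max \<bar>b\<bar> \<bar>d\<bar> = N" "max \<bar>d\<bar> \<bar>c\<bar> = N"
    have "\<bar>b * c - a * d\<bar> = 1" using det by (simp add: algebra_simps)
    then have "N - 1 \<le> \<bar>d\<bar>"
      using h(3,4) by (intro large_entry[of b c a d, OF _ N(1) N(2)]) (simp_all only: max.commute)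
    moreover have "wedge (att A) (att (adj2 A)) = - d * (a + d) + 1"
      unfolding h using det by (simp add: wedge_def column_def abcd algebra_simps)
    ultimately show ?thesis using near' by (intro exI[of _ "- d"] exI[of _ 1]) simp
  next
    assume h: "att A = column 2 A" "att (adj2 A) = column 2 (adj2 A)"
      "max \<bar>b\<bar> \<bar>d\<bar> = N" "max \<bar>a\<bar> \<bar>b\<bar> = N"
    have "\<bar>a * d - c * b\<bar> = 1" using det by (simp add: algebra_simps)
    then have "N - 1 \<le> \<bar>b\<bar>"
      using h(3,4) by (intro large_entry[of a d c b, OF _ N(1) N(4)]) (simp_all only: max.commute)
    moreover have "wedge (att A) (att (adj2 A)) = b * (a + d)"
      unfolding h by (simp add: wedge_def column_def abcd algebra_simps)
    ultimately show ?thesis using near' by (intro exI[of _ b] exI[of _ 0]) simp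
  qed
  then obtain m e where "\<bar>e\<bar> \<le> 1" "N - 1 \<le> \<bar>m\<bar>" "\<bar>m * (a + d) + e\<bar> \<le> 4 * N" by blast
  then show ?thesis
    unfolding abcd(1,4)[symmetric] using N by (intro small_factor[of N m _ e]) auto
qed

section \<open>The lower bound\<close>

definition coprime_pairs :: "nat \<Rightarrow> (int \<times> int) set"
  where "coprime_pairs n = {(p, q) \<in> {1..int n} \<times> {1..int n}. coprime p q}"

lemma finite_coprime_pairs [simp]: "finite (coprime_pairs n)"
  by (rule finite_subset[of _ "{1..int n} \<times> {1..int n}"]) (auto simp: coprime_pairs_def)

text \<open>Since (2 j + 1)^2 \<ge> 4 j (j + 1), the sum is dominated by a telescoping one, whose
  remaining term carries the induction.\<close>

lemma sum_inverse_odd_squares: "(\<Sum>j = 1..n. 1 / (2 * real j + 1)\<^sup>2) \<le> 1 / 4 - 1 / (4 * (real n + 1))"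
proof (induction n)
  case (Suc n)
  have "1 / (2 * real (Suc n) + 1)\<^sup>2 \<le> 1 / (4 * ((real n + 1) * (real n + 2)))"
    by (intro divide_left_mono) (auto simp: power2_eq_square algebra_simps add_pos_nonneg)
  also have "\<dots> = 1 / (4 * (real n + 1)) - 1 / (4 * (real (Suc n) + 1))"
    by (simp add: diff_frac_eq frac_eq_eq) (simp add: algebra_simps)
  finally show ?case using Suc by simp
qed simp

text \<open>A pair that is not coprime is divisible by 2 or by an odd number \<open>\<ge> 3\<close>, and
  \<open>1/4 + (1/9 + 1/25 + 1/49 + \<dots>) \<le> 1/2\<close>.\<close>

lemma card_coprime_pairs: "(real n)\<^sup>2 / 2 \<le> real (card (coprime_pairs n))"
proof -
  let ?I = "{1..int n}"
  define D where "D = (\<lambda>k::nat. {(p, q) \<in> ?I \<times> ?I. int k dvd p \<and> int k dvd q})"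
  have finD: "finite (D k)" for k
    by (rule finite_subset[of _ "?I \<times> ?I"]) (auto simp: D_def)
  have cardD: "real (card (D k)) \<le> (real n / real k)\<^sup>2" if "k > 0" for k
  proof -
    let ?M = "(\<lambda>j. int k * int j) ` {1..n div k}"
    have "D k \<subseteq> ?M \<times> ?M"
    proof -
      have "x \<in> ?M" if x: "x \<in> ?I" "int k dvd x" for x
      proof -
        obtain y where y: "x = int k * y" using x(2) by auto
        have "0 < y" using x y \<open>k > 0\<close> zero_less_mult_pos[of "int k" y] by simp
        then obtain j where j: "y = int j" by (metis zero_less_imp_eq_int)
        have "int (k * j) \<le> int n" using x y j by simp
        then have "j * k \<le> n" by (simp only: of_nat_le_iff mult.commute)
        then have "j \<in> {1..n div k}"
          using \<open>k > 0\<close> \<open>0 < y\<close> j by (simp add: less_eq_div_iff_mult_less_eq)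
        then show ?thesis using y j by blast
      qed
      then show ?thesis by (auto simp: D_def)
    qed
    then have "card (D k) \<le> card (?M \<times> ?M)" by (intro card_mono) auto
    also have "\<dots> \<le> (n div k) * (n div k)"
      unfolding card_cartesian_product by (intro mult_mono order_trans[OF card_image_le]) auto
    finally have "real (card (D k)) \<le> real (n div k) * real (n div k)"
      by (metis of_nat_le_iff of_nat_mult)
    also have "\<dots> \<le> (real n / real k) * (real n / real k)"
      by (intro mult_mono of_nat_div_le_of_nat) auto
    finally show ?thesis by (simp add: power2_eq_square)
  qed
  have "?I \<times> ?I \<subseteq> coprime_pairs n \<union> (D 2 \<union> (\<Union>j \<in> {1..n}. D (2 * j + 1)))"
  proof
    fix z assume "z \<in> ?I \<times> ?I"
    then obtain p q where z: "z = (p, q)" "p \<in> ?I" "q \<in> ?I" by auto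
    show "z \<in> coprime_pairs n \<union> (D 2 \<union> (\<Union>j \<in> {1..n}. D (2 * j + 1)))"
    proof (cases "coprime p q")
      case True
      then show ?thesis using z by (auto simp: coprime_pairs_def)
    next
      case False
      then obtain c where "c dvd p" "c dvd q" "\<not> is_unit c" by (rule not_coprimeE)
      then have c: "int (nat \<bar>c\<bar>) dvd p" "int (nat \<bar>c\<bar>) dvd q" "nat \<bar>c\<bar> \<noteq> 1"
        by auto
      have le: "nat \<bar>c\<bar> \<le> n" "nat \<bar>c\<bar> > 0"
        using zdvd_imp_le[OF c(1)] z(2) c(1) by (auto intro: Nat.gr0I)
      show ?thesis
      proof (cases "even (nat \<bar>c\<bar>)")
        case True
        then have "int 2 dvd int (nat \<bar>c\<bar>)" by (simp only: of_nat_dvd_iff)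
        then have "z \<in> D 2" using c(1,2) z by (auto simp: D_def intro: dvd_trans)
        then show ?thesis by blast
      next
        case False
        then obtain j where j: "nat \<bar>c\<bar> = 2 * j + 1" by (rule oddE)
        then have "z \<in> D (2 * j + 1)" using c(1,2) z by (simp add: D_def)
        moreover have "j \<in> {1..n}" using j le c(3) by auto
        ultimately show ?thesis by blast
      qed
    qed
  qed
  then have "card (?I \<times> ?I) \<le> card (coprime_pairs n \<union> (D 2 \<union> (\<Union>j \<in> {1..n}. D (2 * j + 1))))"
    using finD by (intro card_mono) auto
  also have "\<dots> \<le> card (coprime_pairs n) + (card (D 2) + (\<Sum>j = 1..n. card (D (2 * j + 1))))"
    by (intro order_trans[OF card_Un_le] add_left_mono order_trans[OF card_Un_le] card_UN_le) auto
  finally have "real (n * n)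
      \<le> real (card (coprime_pairs n) + (card (D 2) + (\<Sum>j = 1..n. card (D (2 * j + 1)))))"
    by (simp only: of_nat_le_iff card_cartesian_product card_atLeastAtMost_int) simp
  also have "\<dots> \<le> real (card (coprime_pairs n)) + ((real n)\<^sup>2 / 4 + (real n)\<^sup>2 / 4)"
  proof -
    have "real (card (D 2)) \<le> (real n)\<^sup>2 / 4" using cardD[of 2] by (simp add: power_divide)
    moreover have "(\<Sum>j = 1..n. real (card (D (2 * j + 1)))) \<le> (real n)\<^sup>2 / 4"
    proof -
      have "(\<Sum>j = 1..n. real (card (D (2 * j + 1)))) \<le> (\<Sum>j = 1..n. (real n)\<^sup>2 * (1 / (2 * real j + 1)\<^sup>2))"
      proof (rule sum_mono)
        fix j
        show "real (card (D (2 * j + 1))) \<le> (real n)\<^sup>2 * (1 / (2 * real j + 1)\<^sup>2)"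
          using cardD[of "2 * j + 1"] by (simp add: power_divide add.commute)
      qed
      also have "\<dots> = (real n)\<^sup>2 * (\<Sum>j = 1..n. 1 / (2 * real j + 1)\<^sup>2)"
        by (simp only: sum_distrib_left)
      also have "\<dots> \<le> (real n)\<^sup>2 * (1 / 4)"
      proof (rule mult_left_mono)
        show "(\<Sum>j = 1..n. 1 / (2 * real j + 1)\<^sup>2) \<le> 1 / 4"
          by (rule order_trans[OF sum_inverse_odd_squares]) simp
      qed simp
      finally show ?thesis by simp
    qed
    ultimately show ?thesis by simp
  qed
  finally show ?thesis by (simp add: power2_eq_square)
qed

section \<open>Matrices with a prescribed coprime first column\<close>

text \<open>Reducing a Bezout coefficient modulo \<open>p\<close> gives r \<le> p - 1, and then p s
  = q r + 1 \<le> p q bounds \<open>s\<close>. These bounds make the completed matrix no larger than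
  its first column.\<close>

lemma coprime_completion:
  fixes p q :: int
  assumes "1 \<le> p" "1 \<le> q" "coprime p q"
  shows "\<exists>r s. 0 \<le> r \<and> r < p \<and> 1 \<le> s \<and> s \<le> q \<and> p * s - q * r = 1"
proof -
  obtain u v where uv: "u * p + v * q = 1"
    using bezout_int[of p q] assms(3) by auto
  define r where "r = (- v) mod p"
  have r: "0 \<le> r" "r \<le> p - 1" using assms(1) pos_mod_bound[of p "- v"] by (auto simp: r_def)
  have "[q * r + 1 = q * (- v) + 1] (mod p)"
    unfolding r_def by (intro cong_add cong_mult) auto
  moreover have "q * (- v) + 1 = u * p" using uv by (simp add: algebra_simps)
  ultimately have "p dvd q * r + 1" by (simp add: cong_dvd_iff)
  then obtain s where s: "q * r + 1 = p * s" by auto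
  have "0 < p * s" using s r assms by (simp add: add_nonneg_pos flip: s)
  then have "1 \<le> s" using assms(1) by (simp add: zero_less_mult_iff)
  moreover have "p * s \<le> p * q"
    using mult_left_mono[OF r(2), of q] assms(2) s by (simp add: algebra_simps)
  then have "s \<le> q" using assms(1) by simp
  ultimately show ?thesis using r s by (intro exI[of _ r] exI[of _ s]) auto
qed

text \<open>One completion is fixed for each pair, so that the maps out of
  \<open>coprime_pairs\<close> below are functions of the first column.\<close>

definition completion :: "int \<times> int \<Rightarrow> int \<times> int"
  where "completion = (\<lambda>(p, q). SOME (r, s).
    0 \<le> r \<and> r < p \<and> 1 \<le> s \<and> s \<le> q \<and> p * s - q * r = 1)"

lemma completionD:
  assumes "(p, q) \<in> coprime_pairs n" "completion (p, q) = (r, s)"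
  shows "0 \<le> r" "r < p" "1 \<le> s" "s \<le> q" "p * s - q * r = 1"
proof -
  let ?P = "\<lambda>(r, s). 0 \<le> r \<and> r < p \<and> 1 \<le> s \<and> s \<le> q \<and> p * s - q * r = 1"
  have "\<exists>z. ?P z" using coprime_completion[of p q] assms(1) by (auto simp: coprime_pairs_def)
  then have "?P (completion (p, q))" unfolding completion_def prod.case by (rule someI_ex)
  then show "0 \<le> r" "r < p" "1 \<le> s" "s \<le> q" "p * s - q * r = 1" by (auto simp: assms(2))
qed

definition mat2 :: "int \<Rightarrow> int \<Rightarrow> int \<Rightarrow> int \<Rightarrow> int ^ 2 ^ 2"
  where "mat2 a b c d = vector [vector [a, b], vector [c, d]]"

lemma mat2_nth [simp]:
  "mat2 a b c d $ 1 $ 1 = a" "mat2 a b c d $ 1 $ 2 = b"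
  "mat2 a b c d $ 2 $ 1 = c" "mat2 a b c d $ 2 $ 2 = d"
  by (simp_all add: mat2_def)

lemma mat2_in_ball_iff:
  "mat2 a b c d \<in> SL2Z_ball X \<longleftrightarrow> a * d - b * c = 1 \<and>
    real_of_int \<bar>a\<bar> \<le> X \<and> real_of_int \<bar>b\<bar> \<le> X \<and> real_of_int \<bar>c\<bar> \<le> X \<and> real_of_int \<bar>d\<bar> \<le> X"
  by (auto simp: SL2Z_ball_def SL2Z_def det_2 height_eq of_int_max)

lemma mat2_eq_iff: "mat2 a b c d = mat2 a' b' c' d' \<longleftrightarrow> a = a' \<and> b = b' \<and> c = c' \<and> d = d'"
  by (auto simp: vec2_eq_iff)

text \<open>Each coprime pair yields four matrices: changing signs on the diagonal by \<sigma> and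
  off it by \<tau> preserves the determinant. As \<open>p\<close> and \<open>q\<close> are positive,
  the first column determines the pair and both signs. With at least n^2 / 2 pairs this gives 2
  n^2.\<close>

lemma card_ball_ge:
  assumes "real n \<le> X"
  shows "2 * (real n)\<^sup>2 \<le> real (card (SL2Z_ball X))"
proof -
  let ?S = "{1, -1 :: int}"
  define f where "f = (\<lambda>((\<sigma>, \<tau>), (p, q)). case completion (p, q) of (r, s) \<Rightarrow>
    mat2 (\<sigma> * p) (\<tau> * r) (\<tau> * q) (\<sigma> * s))"
  let ?A = "(?S \<times> ?S) \<times> coprime_pairs n"
  have "inj_on f ?A"
    by (rule inj_onI) (auto simp: f_def mat2_eq_iff coprime_pairs_def split: prod.splits)
  moreover have "f ` ?A \<subseteq> SL2Z_ball X"
  proof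
    fix M assume "M \<in> f ` ?A"
    then obtain \<sigma> \<tau> p q where h: "\<sigma> \<in> ?S" "\<tau> \<in> ?S" "(p, q) \<in> coprime_pairs n" "M = f ((\<sigma>, \<tau>), (p, q))"
      by auto
    obtain r s where rs: "completion (p, q) = (r, s)" by force
    note c = completionD[OF h(3) rs]
    have "p \<le> int n" "q \<le> int n" using h(3) by (auto simp: coprime_pairs_def)
    then have le: "real_of_int t \<le> X" if "t \<le> p \<or> t \<le> q" for t
      using that assms by linarith
    have "M = mat2 (\<sigma> * p) (\<tau> * r) (\<tau> * q) (\<sigma> * s)" by (simp add: h(4) f_def rs)
    moreover have \<sigma>\<tau>: "\<sigma> * \<sigma> = 1" "\<tau> * \<tau> = 1" "\<bar>\<sigma>\<bar> = 1" "\<bar>\<tau>\<bar> = 1" using h(1,2) by auto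
    moreover have "(\<sigma> * p) * (\<sigma> * s) - (\<tau> * r) * (\<tau> * q) = (\<sigma> * \<sigma>) * (p * s) - (\<tau> * \<tau>) * (q * r)"
      by (simp add: mult_ac)
    then have "(\<sigma> * p) * (\<sigma> * s) - (\<tau> * r) * (\<tau> * q) = 1"
      unfolding \<sigma>\<tau> using c(5) by simp
    ultimately show "M \<in> SL2Z_ball X"
      using c le[of p] le[of q] le[of r] le[of s] by (simp add: mat2_in_ball_iff abs_mult)
  qed
  ultimately have "card ?A \<le> card (SL2Z_ball X)"
    by (rule card_inj_on_le[OF _ _ finite_SL2Z_ball])
  then have "real (4 * card (coprime_pairs n)) \<le> real (card (SL2Z_ball X))"
    by (simp add: card_cartesian_product)
  then show ?thesis using card_coprime_pairs[of n] by simp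
qed

text \<open>The conjugates \<open>g J g\<inverse>\<close> of the rotation \<open>J\<close> of order 4, where \<open>g\<close> has first column \<open>(p, q)\<close>.\<close>

lemma card_trace_zero_ge:
  assumes "2 * (real m)\<^sup>2 \<le> X"
  shows "(real m)\<^sup>2 / 2 \<le> real (card {A \<in> SL2Z_ball X. A $ 1 $ 1 + A $ 2 $ 2 = 0})"
proof -
  \<comment> \<open>For g with rows (p, r), (q, s) and J with rows (0, -1), (1, 0), this is the
    product of g, J and the inverse of g.\<close>
  define f where "f = (\<lambda>(p, q). case completion (p, q) of (r, s) \<Rightarrow>
    mat2 (r * s + p * q) (- (r * r) - p * p) (s * s + q * q) (- (r * s) - p * q))"
  have "inj_on f (coprime_pairs m)"
  proof (rule inj_onI)
    fix z z' assume z: "z \<in> coprime_pairs m" "z' \<in> coprime_pairs m" and eq: "f z = f z'"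
    obtain p q p' q' where pq: "z = (p, q)" "z' = (p', q')" by (metis surj_pair)
    obtain r s r' s' where rs: "completion (p, q) = (r, s)" "completion (p', q') = (r', s')"
      by (metis surj_pair)
    have pos: "1 \<le> p" "1 \<le> q" "1 \<le> p'" "1 \<le> q'" using z by (auto simp: coprime_pairs_def pq)
    note c = completionD[OF z(1)[unfolded pq] rs(1)]
    note c' = completionD[OF z(2)[unfolded pq] rs(2)]
    have e: "r * s + p * q = r' * s' + p' * q'" "r * r + p * p = r' * r' + p' * p'"
      "s * s + q * q = s' * s' + q' * q'"
      using eq by (auto simp: f_def pq rs mat2_eq_iff)
    \<comment> \<open>Equal conjugates mean that g^-1 g' commutes with J, so it is a rotation
      matrix. The two squared terms come from its first column, so that column is an integer point
      of the unit circle.\<close>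
    have circle: "(p' * s - q' * r)\<^sup>2 + (p * q' - q * p')\<^sup>2 = 1"
    proof -
      have "(p' * s - q' * r)\<^sup>2 + (p * q' - q * p')\<^sup>2 =
          p' * p' * (s * s + q * q) - 2 * p' * q' * (r * s + p * q) + q' * q' * (r * r + p * p)"
        by (simp add: power2_eq_square algebra_simps)
      also have "\<dots> = (p' * s' - q' * r')\<^sup>2"
        unfolding e by (simp add: power2_eq_square algebra_simps)
      finally show ?thesis using c'(5) by simp
    qed
    have circle': "(p * s' - q * r')\<^sup>2 + (p' * q - q' * p)\<^sup>2 = 1"
    proof -
      have "(p * s' - q * r')\<^sup>2 + (p' * q - q' * p)\<^sup>2 =
          p * p * (s' * s' + q' * q') - 2 * p * q * (r' * s' + p' * q') + q * q * (r' * r' + p' * p')"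
        by (simp add: power2_eq_square algebra_simps)
      also have "\<dots> = (p * s - q * r)\<^sup>2"
        unfolding e[symmetric] by (simp add: power2_eq_square algebra_simps)
      finally show ?thesis using c(5) by simp
    qed
    define x y x' where "x = p' * s - q' * r" and "y = p * q' - q * p'" and "x' = p * s' - q * r'"
    have circ: "x\<^sup>2 + y\<^sup>2 = 1" "x'\<^sup>2 + y\<^sup>2 = 1"
      using circle circle' by (simp_all add: x_def y_def x'_def power2_eq_square algebra_simps)
    \<comment> \<open>The first column of g' is g applied to the point (x, y), and the first column
      of g is g' applied to (x', -y).\<close>
    have dec: "p' = x * p + y * r" "q' = x * q + y * s" "p = x' * p' - y * r'" "q = x' * q' - y * s'"
    proof -
      have "x * p + y * r = p' * (p * s - q * r)" "x * q + y * s = q' * (p * s - q * r)"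
        "x' * p' - y * r' = p * (p' * s' - q' * r')" "x' * q' - y * s' = q * (p' * s' - q' * r')"
        by (simp_all add: x_def y_def x'_def algebra_simps)
      then show "p' = x * p + y * r" "q' = x * q + y * s" "p = x' * p' - y * r'" "q = x' * q' - y * s'"
        using c(5) c'(5) by auto
    qed
    show "z = z'"
    proof (cases "y = 0")
      case True
      then have "x = 1 \<or> x = -1" using circ(1) by (simp add: power2_eq_1_iff)
      then show ?thesis using dec(1,2) True pos pq by auto
    next
      \<comment> \<open>Here y is 1 or -1 while q' = y s and q = -y s', which contradicts the
        positivity of all four numbers.\<close>
      case False
      then have "1 \<le> y\<^sup>2" by (simp add: int_one_le_iff_zero_less)
      then have "x\<^sup>2 \<le> 0" "x'\<^sup>2 \<le> 0" using circ by linarith+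
      then have 0: "x = 0" "x' = 0" by auto
      then have "y = 1 \<or> y = -1" using circ(1) by (simp add: power2_eq_1_iff)
      then show ?thesis using dec(2,4) 0 pos c(3) c'(3) by auto
    qed
  qed
  moreover have "f ` coprime_pairs m \<subseteq> {A \<in> SL2Z_ball X. A $ 1 $ 1 + A $ 2 $ 2 = 0}"
  proof
    fix M assume "M \<in> f ` coprime_pairs m"
    then obtain p q where h: "(p, q) \<in> coprime_pairs m" "M = f (p, q)" by auto
    obtain r s where rs: "completion (p, q) = (r, s)" by force
    note c = completionD[OF h(1) rs]
    have M: "M = mat2 (r * s + p * q) (- (r * r) - p * p) (s * s + q * q) (- (r * s) - p * q)"
      by (simp add: h(2) f_def rs)
    have le: "0 \<le> p" "0 \<le> q" "p \<le> int m" "q \<le> int m" "0 \<le> r" "0 \<le> s" "r \<le> int m" "s \<le> int m"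
      using h(1) c by (auto simp: coprime_pairs_def)
    have bound: "real_of_int \<bar>t * u + v * w\<bar> \<le> X"
      if "t \<in> {0..int m}" "u \<in> {0..int m}" "v \<in> {0..int m}" "w \<in> {0..int m}" for t u v w
    proof -
      have "t * u \<le> int m * int m" "v * w \<le> int m * int m" "0 \<le> t * u" "0 \<le> v * w"
        using that by (auto intro!: mult_mono)
      then have "\<bar>t * u + v * w\<bar> \<le> int m * int m + int m * int m" by linarith
      then have "real_of_int \<bar>t * u + v * w\<bar> \<le> real_of_int (int m * int m + int m * int m)"
        by (simp only: of_int_le_iff)
      then show ?thesis using assms by (simp add: power2_eq_square)
    qed
    have "(r * s + p * q) * (- (r * s) - p * q) - (- (r * r) - p * p) * (s * s + q * q)
        = (p * s - q * r)\<^sup>2"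
      by (simp add: power2_eq_square algebra_simps)
    moreover have "\<bar>- (r * r) - p * p\<bar> = \<bar>r * r + p * p\<bar>" "\<bar>- (r * s) - p * q\<bar> = \<bar>r * s + p * q\<bar>"
      by linarith+
    ultimately have "M \<in> SL2Z_ball X"
      using c(5) bound[of r s p q] bound[of r r p p] bound[of s s q q] le
      by (simp only: M mat2_in_ball_iff) simp
    then show "M \<in> {A \<in> SL2Z_ball X. A $ 1 $ 1 + A $ 2 $ 2 = 0}" by (simp add: M)
  qed
  moreover have "finite {A \<in> SL2Z_ball X. A $ 1 $ 1 + A $ 2 $ 2 = 0}"
    using finite_SL2Z_ball by simp
  ultimately have "card (coprime_pairs m) \<le> card {A \<in> SL2Z_ball X. A $ 1 $ 1 + A $ 2 $ 2 = 0}"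
    by (rule card_inj_on_le)
  then show ?thesis using card_coprime_pairs[of m] by linarith
qed

text \<open>By Cayley-Hamilton, determinant 1 and trace 0 give A^2 = -I.\<close>

lemma trace_zero_pow4:
  fixes A :: "int ^ 2 ^ 2"
  assumes "det A = 1" "A $ 1 $ 1 + A $ 2 $ 2 = 0"
  shows "A ** (A ** (A ** A)) = mat 1"
proof -
  have d: "A $ 2 $ 2 = - A $ 1 $ 1" using assms(2) by linarith
  then have e: "A $ 1 $ 2 * A $ 2 $ 1 = - 1 - A $ 1 $ 1 * A $ 1 $ 1" using assms(1) by (simp add: det_2)
  have "A ** A = mat (-1)"
    using e by (simp add: vec2_eq_iff matrix_matrix_mult_def mat_def sum_2 d mult.commute)
  moreover have "mat (-1) ** mat (-1) = (mat 1 :: int ^ 2 ^ 2)"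
    by (simp add: vec2_eq_iff matrix_matrix_mult_def mat_def sum_2)
  ultimately show ?thesis by (simp add: matrix_mul_assoc)
qed

lemma nonfree_trace_zero:
  assumes "det A = 1" "A $ 1 $ 1 + A $ 2 $ 2 = 0" "set (A # As) \<subseteq> carrier SL2Z"
  shows "\<not> free_tuple SL2Z (A # As)"
proof -
  let ?x = "(0, 1) :: nat \<times> int"
  let ?w = "[?x, ?x, ?x, ?x]"
  have "?w \<in> words (length (A # As))" by (simp add: words_def)
  moreover have "reduced ?w" by (simp add: reduced_Cons_Cons) (simp add: reduced_def)
  moreover have "word_value SL2Z (A # As) ?w = \<one>\<^bsub>SL2Z\<^esub>"
    using trace_zero_pow4[OF assms(1,2)] word_value_Cons[OF assms(3), of ?x]
    by (simp add: letter_def) (simp add: word_value_def SL2Z_def)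
  ultimately show ?thesis unfolding free_tuple_def by blast
qed

lemma N_nonfree_ge:
  assumes "X \<ge> 16" "s \<ge> 1"
  shows "1 / 16 * X powr (2 * real s - 1) \<le> real (N_nonfree s X)"
proof -
  let ?T = "{A \<in> SL2Z_ball X. A $ 1 $ 1 + A $ 2 $ 2 = 0}"
  let ?L = "{As. set As \<subseteq> SL2Z_ball X \<and> length As = s - 1}"
  have "X\<^sup>2 \<le> real (card (SL2Z_ball X))"
  proof -
    define n where "n = nat \<lfloor>X\<rfloor>"
    have n: "real n \<le> X" "X - 1 \<le> real n" using assms unfolding n_def by linarith+
    \<comment> \<open>Rounding \<open>X\<close> down costs at most a factor 4/3, and 16/9 is below
      the 2 of \<open>card_ball_ge\<close>. The coefficient 1 in front of X^2 survives the power s -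
      1 below.\<close>
    have "X * X \<le> (4 / 3 * (X - 1)) * (4 / 3 * (X - 1))"
      using assms by (intro mult_mono) auto
    also have "\<dots> \<le> (4 / 3 * real n) * (4 / 3 * real n)"
      using assms n by (intro mult_mono) auto
    also have "\<dots> = 16 / 9 * (real n)\<^sup>2" by (simp add: power2_eq_square)
    also have "\<dots> \<le> 2 * (real n)\<^sup>2" by simp
    also have "\<dots> \<le> real (card (SL2Z_ball X))" using n by (intro card_ball_ge)
    finally show ?thesis by (simp add: power2_eq_square)
  qed
  moreover have "X / 16 \<le> real (card ?T)"
  proof -
    define m where "m = nat \<lfloor>sqrt (X / 2)\<rfloor>"
    \<comment> \<open>Since the root is at least 2, rounding it down loses at most half: m^2 is at
      least X/8, and half of that bounds the number of coprime pairs, whence X/16.\<close>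
    have sq: "2 \<le> sqrt (X / 2)" using assms by (simp add: real_le_rsqrt)
    have m: "real m \<le> sqrt (X / 2)" "sqrt (X / 2) - 1 \<le> real m"
      using sq unfolding m_def by linarith+
    have "(real m)\<^sup>2 \<le> (sqrt (X / 2))\<^sup>2" using m assms by (intro power_mono) auto
    then have "2 * (real m)\<^sup>2 \<le> X" using assms by simp
    have "(sqrt (X / 2) / 2)\<^sup>2 \<le> (real m)\<^sup>2" 
      using m sq assms by (intro power_mono) auto
    then have "X / 8 \<le> (real m)\<^sup>2" using assms by (simp add: power_divide)
    then show ?thesis using card_trace_zero_ge[OF \<open>2 * (real m)\<^sup>2 \<le> X\<close>] by linarith
  qed
  ultimately have "X / 16 * (X\<^sup>2) ^ (s - 1) \<le> real (card ?T) * real (card (SL2Z_ball X)) ^ (s - 1)"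
    using assms by (intro mult_mono power_mono) auto
  also have "\<dots> = real (card (?T \<times> ?L))"
    using card_lists_length_eq[OF finite_SL2Z_ball, of X "s - 1"] by (simp add: card_cartesian_product)
  also have "card (?T \<times> ?L) \<le> card (nonfree_tuples s X)"
  proof (rule card_inj_on_le[OF _ _ finite_nonfree_tuples])
    show "inj_on (\<lambda>(A, As). A # As) (?T \<times> ?L)" by (auto simp: inj_on_def)
    show "(\<lambda>(A, As). A # As) ` (?T \<times> ?L) \<subseteq> nonfree_tuples s X"
    proof clarify
      fix A As assume h: "A \<in> SL2Z_ball X" "A $ 1 $ 1 + A $ 2 $ 2 = 0"
        "set As \<subseteq> SL2Z_ball X" "length As = s - 1"
      have "\<not> free_tuple SL2Z (A # As)"
        using h by (intro nonfree_trace_zero) (auto simp: SL2Z_ball_def SL2Z_def)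
      then show "A # As \<in> nonfree_tuples s X"
        using h assms(2) by (auto simp: nonfree_tuples_def)
    qed
  qed
  finally have "X / 16 * (X\<^sup>2) ^ (s - 1) \<le> real (N_nonfree s X)" by (simp add: N_nonfree_def)
  moreover have "X powr (2 * real s - 1) = X * (X\<^sup>2) ^ (s - 1)"
  proof -
    have "2 * real s - 1 = real (Suc (2 * (s - 1)))" using assms(2) by (simp add: of_nat_diff)
    then have "X powr (2 * real s - 1) = X ^ Suc (2 * (s - 1))"
      using assms(1) by (simp only: powr_realpow)
    then show ?thesis by (simp add: power_mult)
  qed
  ultimately show ?thesis by simp
qed

section \<open>The divisor bound\<close>

text \<open>Every divisor of the product has the form p^i e with i \<le> k and e dividing
  \<open>m\<close>.\<close>

lemma card_divisors_prime_power_mult: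
  fixes p m :: nat
  assumes "prime p" "m > 0"
  shows "card {d. d dvd p ^ k * m} \<le> (k + 1) * card {d. d dvd m}"
proof -
  have "{d. d dvd p ^ k * m} \<subseteq> (\<lambda>(i, e). p ^ i * e) ` ({..k} \<times> {d. d dvd m})"
  proof
    fix d assume "d \<in> {d. d dvd p ^ k * m}"
    then obtain b c where "d = b * c" "b dvd p ^ k" "c dvd m"
      using division_decomp by blast
    then show "d \<in> (\<lambda>(i, e). p ^ i * e) ` ({..k} \<times> {d. d dvd m})"
      using divides_primepow_nat[OF assms(1)] by (auto simp: image_iff)
  qed
  then have "card {d. d dvd p ^ k * m} \<le> card ({..k} \<times> {d. d dvd m})"
    using assms by (intro surj_card_le) auto
  then show ?thesis by (simp add: card_cartesian_product)
qed

text \<open>Prime powers are split off one at a time, comparing the factor k + 1 with p^(k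
  \<epsilon>). A prime of size at least \<open>P\<close> costs nothing, and each smaller one costs a
  factor \<open>c\<close>. As there are boundedly many small primes, the total loss is a
  constant.\<close>

lemma card_divisors_bound:
  fixes \<epsilon> :: real
  assumes "\<epsilon> > 0"
  shows "\<exists>C\<ge>1. \<forall>n>0. real (card {d. d dvd n}) \<le> C * real n powr \<epsilon>"
proof -
  \<comment> \<open>Chosen so that \<open>P powr \<epsilon>\<close> is 2, which reduces large primes
    to k + 1 \<le> 2^k.\<close>
  define P where "P = 2 powr (1 / \<epsilon>)"
  \<comment> \<open>Chosen so that k + 1 \<le> c (1 + k \<epsilon> ln 2), where the bracket is at
    most 2^(k \<epsilon>) by the exponential inequality.\<close>
  define c where "c = 1 + 1 / (\<epsilon> * ln 2)"
  define S where "S = (\<lambda>n. {p::nat. prime p \<and> p dvd n \<and> real p < P})"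
  have c1: "c \<ge> 1" using assms by (simp add: c_def)
  have small: "real (k + 1) \<le> c * real p powr (real k * \<epsilon>)" if "p \<ge> 2" for k p :: nat
  proof -
    have "1 + real k * \<epsilon> * ln 2 \<le> exp (real k * \<epsilon> * ln 2)" by (rule exp_ge_add_one_self)
    also have "\<dots> = 2 powr (real k * \<epsilon>)" by (simp add: powr_def)
    also have "\<dots> \<le> real p powr (real k * \<epsilon>)"
      using that assms by (intro powr_mono2) auto
    finally have *: "1 + real k * \<epsilon> * ln 2 \<le> real p powr (real k * \<epsilon>)" .
    have "real (k + 1) \<le> c * (1 + real k * \<epsilon> * ln 2)"
      using assms by (simp add: c_def field_simps)
    also have "\<dots> \<le> c * real p powr (real k * \<epsilon>)"
      using * c1 by (intro mult_left_mono) auto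
    finally show ?thesis .
  qed
  have large: "real (k + 1) \<le> real p powr (real k * \<epsilon>)" if "real p \<ge> P" for k p :: nat
  proof -
    have "k + 1 \<le> 2 ^ k" by (induction k) auto
    then have "real (k + 1) \<le> 2 ^ k" by (metis of_nat_le_iff of_nat_numeral of_nat_power)
    also have "\<dots> = P powr (real k * \<epsilon>)"
      using assms by (simp add: P_def powr_powr powr_realpow)
    also have "\<dots> \<le> real p powr (real k * \<epsilon>)"
      using that assms by (intro powr_mono2) (auto simp: P_def)
    finally show ?thesis .
  qed
  have fin: "finite (S n)" for n
    by (rule finite_subset[of _ "{..nat \<lfloor>P\<rfloor>}"]) (auto simp: S_def le_nat_floor)
  have main: "real (card {d. d dvd n}) \<le> c ^ card (S n) * real n powr \<epsilon>" if "n > 0" for n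
    using that
  proof (induction n rule: less_induct)
    case (less n)
    show ?case
    proof (cases "n = 1")
      case True
      then show ?thesis using one_le_power[OF c1] by simp
    next
      case False
      then obtain p where p: "prime p" "p dvd n"
        using prime_factor_nat by blast
      obtain k m where km: "\<not> p dvd m" "n = m * p ^ k"
        using prime_power_canonical[OF p(1) less.prems] by blast
      have k: "k > 0" using km p by (cases k) auto
      have m: "m > 0" using km less.prems by (cases m) auto
      have p2: "p \<ge> 2" using p(1) by (rule prime_ge_2_nat)
      have "1 < p ^ k" using k p2 by (intro one_less_power) auto
      then have "m < n" using km m by simp
      have npow: "real n powr \<epsilon> = real p powr (real k * \<epsilon>) * real m powr \<epsilon>"
        using p2 m by (simp add: km(2) powr_mult powr_realpow[symmetric] powr_powr)
      have "real (card {d. d dvd n}) \<le> real ((k + 1) * card {d. d dvd m})"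
        using card_divisors_prime_power_mult[OF p(1) m, of k] km(2)
        by (metis mult.commute of_nat_le_iff)
      also have "\<dots> = real (k + 1) * real (card {d. d dvd m})" by (simp only: of_nat_mult)
      also have "\<dots> \<le> real (k + 1) * (c ^ card (S m) * real m powr \<epsilon>)"
        using less.IH[OF \<open>m < n\<close> m] by (intro mult_left_mono) auto
      also have "\<dots> \<le> c ^ card (S n) * real n powr \<epsilon>"
      proof (cases "real p < P")
        case True
        have "insert p (S m) \<subseteq> S n" "p \<notin> S m"
          using True p km by (auto simp: S_def)
        then have "Suc (card (S m)) \<le> card (S n)"
          by (metis card_insert_disjoint card_mono fin)
        then have "c ^ Suc (card (S m)) \<le> c ^ card (S n)"
          using c1 by (intro power_increasing)
        have "real (k + 1) * (c ^ card (S m) * real m powr \<epsilon>)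
            \<le> (c * real p powr (real k * \<epsilon>)) * (c ^ card (S m) * real m powr \<epsilon>)"
          using small[OF p2] c1 by (intro mult_right_mono) auto
        also have "\<dots> = c ^ Suc (card (S m)) * real n powr \<epsilon>" by (simp add: npow)
        also have "\<dots> \<le> c ^ card (S n) * real n powr \<epsilon>"
          by (intro mult_right_mono) (fact, simp)
        finally show ?thesis .
      next
        case False
        have "S m \<subseteq> S n" using km by (auto simp: S_def)
        then have "c ^ card (S m) \<le> c ^ card (S n)"
          using c1 by (intro power_increasing card_mono fin)
        have "real (k + 1) * (c ^ card (S m) * real m powr \<epsilon>)
            \<le> real p powr (real k * \<epsilon>) * (c ^ card (S m) * real m powr \<epsilon>)"
          using large[of p k] False c1 by (intro mult_right_mono) auto
        also have "\<dots> = c ^ card (S m) * real n powr \<epsilon>" by (simp add: npow)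
        also have "\<dots> \<le> c ^ card (S n) * real n powr \<epsilon>"
          by (intro mult_right_mono) (fact, simp)
        finally show ?thesis .
      qed
      finally show ?thesis .
    qed
  qed
  have "card (S n) \<le> Suc (nat \<lfloor>P\<rfloor>)" for n
    using card_mono[of "{..nat \<lfloor>P\<rfloor>}" "S n"] by (force simp: S_def le_nat_floor)
  then have "c ^ card (S n) * real n powr \<epsilon> \<le> c ^ Suc (nat \<lfloor>P\<rfloor>) * real n powr \<epsilon>" for n
    using c1 by (intro mult_right_mono power_increasing) auto
  then show ?thesis
    using main one_le_power[OF c1] order_trans by (intro exI[of _ "c ^ Suc (nat \<lfloor>P\<rfloor>)"]) blast
qed

text \<open>A factorization is determined by the sign of its first factor and by the absolute value
  of that factor, a divisor of |n|.\<close>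

lemma card_factorizations_bound:
  fixes \<epsilon> :: real
  assumes "\<epsilon> > 0"
  shows "\<exists>C\<ge>1. \<forall>n::int. n \<noteq> 0 \<longrightarrow> finite {(x, y). x * y = n} \<and>
    real (card {(x, y). x * y = n}) \<le> C * real_of_int \<bar>n\<bar> powr \<epsilon>"
proof -
  obtain C where C: "C \<ge> 1" "\<And>n. n > 0 \<Longrightarrow> real (card {d. d dvd n}) \<le> C * real n powr \<epsilon>"
    using card_divisors_bound[OF assms] by blast
  have "finite {(x, y). x * y = n} \<and>
      real (card {(x, y). x * y = n}) \<le> 2 * C * real_of_int \<bar>n\<bar> powr \<epsilon>" if n: "n \<noteq> 0" for n :: int
  proof -
    let ?D = "{d. d dvd nat \<bar>n\<bar>}"
    let ?f = "\<lambda>(e, d). (e * int d, n div (e * int d))"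
    have fD: "finite ?D" using n by (intro finite_divisors_nat) simp
    have sub: "{(x, y). x * y = n} \<subseteq> ?f ` ({1, -1} \<times> ?D)"
    proof
      fix z assume "z \<in> {(x, y). x * y = n}"
      then obtain x y where z: "z = (x, y)" and xy: "n = x * y" by auto
      then have "nat \<bar>x\<bar> \<in> ?D" "x \<noteq> 0" using n by (auto simp: nat_abs_mult_distrib)
      moreover have "(x, y) = ?f (sgn x, nat \<bar>x\<bar>)"
        using \<open>x \<noteq> 0\<close> xy by (simp add: sgn_mult_abs)
      moreover have "sgn x \<in> {1, -1}" using \<open>x \<noteq> 0\<close> by (auto simp: sgn_if)
      ultimately show "z \<in> ?f ` ({1, -1} \<times> ?D)" 
        unfolding z by (intro image_eqI[of _ _ "(sgn x, nat \<bar>x\<bar>)"] SigmaI)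
    qed
    then have "card {(x, y). x * y = n} \<le> card ({1, -1 :: int} \<times> ?D)"
      using fD by (intro surj_card_le) auto
    then have "real (card {(x, y). x * y = n}) \<le> 2 * real (card ?D)"
      by (simp add: card_cartesian_product)
    also have "real (card ?D) \<le> C * real (nat \<bar>n\<bar>) powr \<epsilon>"
      using n by (intro C(2)) auto
    finally show ?thesis
      using finite_subset[OF sub] fD by simp
  qed
  then show ?thesis using C(1) by (intro exI[of _ "2 * C"]) auto
qed

section \<open>The upper bound\<close>

definition box :: "nat \<Rightarrow> int set"
  where "box n = {- int n..int n}"

lemma finite_box [simp]: "finite (box n)"
  by (simp add: box_def)

lemma abs_le_iff_box: "\<bar>x\<bar> \<le> int n \<longleftrightarrow> x \<in> box n"
  by (auto simp: box_def)

lemma card_box_le: "n \<ge> 1 \<Longrightarrow> real (card (box n)) \<le> 3 * real n"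
  by (simp add: box_def)

definition fac :: "nat \<Rightarrow> int \<Rightarrow> (int \<times> int) set"
  where "fac n m = {(x, y) \<in> box n \<times> box n. x * y = m}"

lemma finite_fac [simp]: "finite (fac n m)"
  by (rule finite_subset[of _ "box n \<times> box n"]) (auto simp: fac_def)

lemma card_fac_zero_le:
  assumes "n \<ge> 1"
  shows "real (card (fac n 0)) \<le> 6 * real n"
proof -
  have "fac n 0 \<subseteq> ({0} \<times> box n) \<union> (box n \<times> {0})" by (auto simp: fac_def)
  then have "card (fac n 0) \<le> card (({0} \<times> box n) \<union> (box n \<times> {0}))" by (intro card_mono) auto
  also have "\<dots> \<le> card (box n) + card (box n)"
    by (rule order_trans[OF card_Un_le]) (simp add: card_cartesian_product)
  finally show ?thesis using card_box_le[OF assms] by linarith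
qed

text \<open>The exponent \<delta>/2 is used for |m|, which is of order n^2. The constant 20 leaves
  room for all products that occur below.\<close>

lemma card_fac_bound:
  fixes \<delta> :: real
  assumes "\<delta> > 0"
  shows "\<exists>C\<ge>1. \<forall>n\<ge>1. \<forall>m. m \<noteq> 0 \<longrightarrow> \<bar>m\<bar> \<le> 20 * (int n)\<^sup>2 \<longrightarrow>
    real (card (fac n m)) \<le> C * real n powr \<delta>"
proof -
  obtain C where C: "C \<ge> 1" "\<And>m::int. m \<noteq> 0 \<Longrightarrow> finite {(x, y). x * y = m}"
    "\<And>m::int. m \<noteq> 0 \<Longrightarrow> real (card {(x, y). x * y = m}) \<le> C * real_of_int \<bar>m\<bar> powr (\<delta> / 2)"
    using card_factorizations_bound[of "\<delta> / 2"] assms by auto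
  have "real (card (fac n m)) \<le> C * 20 powr (\<delta> / 2) * real n powr \<delta>"
    if n: "n \<ge> 1" and m: "m \<noteq> 0" "\<bar>m\<bar> \<le> 20 * (int n)\<^sup>2" for n m
  proof -
    have "card (fac n m) \<le> card {(x, y). x * y = m}"
      using C(2)[OF m(1)] by (intro card_mono) (auto simp: fac_def)
    then have "real (card (fac n m)) \<le> real (card {(x, y). x * y = m})" by simp
    also have "\<dots> \<le> C * real_of_int \<bar>m\<bar> powr (\<delta> / 2)" using m(1) by (rule C(3))
    also have "real_of_int \<bar>m\<bar> \<le> real_of_int (20 * (int n)\<^sup>2)" using m(2) by (simp only: of_int_le_iff)
    then have "C * real_of_int \<bar>m\<bar> powr (\<delta> / 2) \<le> C * (20 * (real n)\<^sup>2) powr (\<delta> / 2)"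
      using C(1) assms by (intro mult_left_mono powr_mono2) auto
    also have "((real n)\<^sup>2) powr (\<delta> / 2) = real n powr \<delta>"
      using n powr_powr[of "real n" 2 "\<delta> / 2"] by simp
    then have "C * (20 * (real n)\<^sup>2) powr (\<delta> / 2) = C * 20 powr (\<delta> / 2) * real n powr \<delta>"
      by (simp add: powr_mult)
    finally show ?thesis .
  qed
  moreover have "1 \<le> C * 20 powr (\<delta> / 2)"
    using C(1) assms by (simp add: ge_one_powr_ge_zero mult_ge1_I)
  ultimately show ?thesis by (intro exI[of _ "C * 20 powr (\<delta> / 2)"]) blast
qed

text \<open>The common counting scheme: \<open>i\<close> collects the unknowns that are fixed, and
  the other two have product \<open>g i\<close>. The divisor bound covers nonzero products; a zero
  product allows about n pairs, so such \<open>i\<close> are counted separately.\<close>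

lemma card_Sigma_fac_le:
  assumes I: "finite I" and n: "n \<ge> 1" and K: "0 \<le> K"
    "\<And>m. m \<noteq> 0 \<Longrightarrow> \<bar>m\<bar> \<le> b \<Longrightarrow> real (card (fac n m)) \<le> K"
    and g: "\<And>i. i \<in> I \<Longrightarrow> \<bar>g i\<bar> \<le> b"
  shows "real (card (SIGMA i:I. fac n (g i))) \<le> K * real (card I) + 6 * real n * real (card {i \<in> I. g i = 0})"
proof -
  have "real (card (SIGMA i:I. fac n (g i))) = (\<Sum>i\<in>I. real (card (fac n (g i))))"
    using I by (simp add: card_SigmaI)
  also have "\<dots> \<le> (\<Sum>i\<in>I. K + (if g i = 0 then 6 * real n else 0))"
  proof (rule sum_mono)
    fix i assume "i \<in> I"
    then show "real (card (fac n (g i))) \<le> K + (if g i = 0 then 6 * real n else 0)"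
      using K g[of i] card_fac_zero_le[OF n] by (cases "g i = 0") auto
  qed
  also have "\<dots> = K * real (card I) + 6 * real n * real (card {i \<in> I. g i = 0})"
    using I by (simp add: sum.distrib sum.If_cases Int_def mult.commute)
  finally show ?thesis .
qed

lemma mult_abs_le_square:
  fixes x y :: int
  assumes "x \<in> box n" "y \<in> box n"
  shows "\<bar>x * y\<bar> \<le> (int n)\<^sup>2"
  using assms unfolding abs_mult power2_eq_square abs_le_iff_box[symmetric]
  by (intro mult_mono) auto

lemma SL2Z_ballD:
  assumes "A \<in> SL2Z_ball X"
  shows "det A = 1" "A $ i $ j \<in> box (nat \<lfloor>X\<rfloor>)"
proof -
  show "det A = 1" using assms by (simp add: SL2Z_ball_def SL2Z_def)
  have "0 \<le> height A" "height A \<le> \<lfloor>X\<rfloor>"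
    using assms abs_entry_le_height[of A i j] by (auto simp: SL2Z_ball_def le_floor_iff)
  then have "\<bar>A $ i $ j\<bar> \<le> int (nat \<lfloor>X\<rfloor>)"
    using abs_entry_le_height[of A i j] nat_0_le[of "\<lfloor>X\<rfloor>"] by linarith
  then show "A $ i $ j \<in> box (nat \<lfloor>X\<rfloor>)" by (simp only: abs_le_iff_box)
qed

lemma SL2Z_ball_off_diagonal:
  assumes "A \<in> SL2Z_ball X"
  shows "A $ 1 $ 2 * A $ 2 $ 1 = A $ 1 $ 1 * A $ 2 $ 2 - 1"
  using SL2Z_ballD(1)[OF assms] by (simp add: det_2)

definition near_pairs :: "nat \<Rightarrow> ((int ^ 2) \<times> (int ^ 2)) set"
  where "near_pairs n = {(p, v). vheight p \<le> int n \<and> vheight v \<le> int n \<and> \<bar>wedge p v\<bar> \<le> 4 * int n}"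

section \<open>Counts of matrices and of nearly parallel vectors, given a bound K on
  factorizations\<close>

context
  fixes n :: nat and K X :: real
  assumes n: "n \<ge> 1" and nX: "n = nat \<lfloor>X\<rfloor>" and K1: "1 \<le> K"
    and K: "\<And>m. m \<noteq> 0 \<Longrightarrow> \<bar>m\<bar> \<le> 20 * (int n)\<^sup>2 \<Longrightarrow> real (card (fac n m)) \<le> K"
begin

lemma n_le_square: "int n \<le> (int n)\<^sup>2"
  using n by (simp add: power2_eq_square)

text \<open>The diagonal is fixed and the off-diagonal entries have product ad - 1, which vanishes
  for at most 4 diagonals: 33 = 9 + 24.\<close>

lemma card_ball_le: "real (card (SL2Z_ball X)) \<le> 33 * K * (real n)\<^sup>2"
proof -
  let ?g = "\<lambda>(a, d). a * d - 1"
  let ?I = "box n \<times> box n"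
  have "card (SL2Z_ball X) \<le> card (SIGMA i:?I. fac n (?g i))"
  proof (rule card_inj_on_le)
    show "inj_on (\<lambda>A. ((A $ 1 $ 1, A $ 2 $ 2), (A $ 1 $ 2, A $ 2 $ 1))) (SL2Z_ball X)"
      by (rule inj_onI) (simp add: vec2_eq_iff)
    show "(\<lambda>A. ((A $ 1 $ 1, A $ 2 $ 2), (A $ 1 $ 2, A $ 2 $ 1))) ` SL2Z_ball X
        \<subseteq> (SIGMA i:?I. fac n (?g i))"
      using SL2Z_ballD(2) SL2Z_ball_off_diagonal unfolding nX by (auto simp: fac_def)
  qed (intro finite_SigmaI; simp)
  then have "real (card (SL2Z_ball X)) \<le> real (card (SIGMA i:?I. fac n (?g i)))" by (simp only: of_nat_le_iff)
  also have "\<dots> \<le> K * real (card ?I) + 6 * real n * real (card {i \<in> ?I. ?g i = 0})"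
  proof (rule card_Sigma_fac_le[OF _ n _ K])
    fix i assume "i \<in> ?I"
    then obtain a d where i: "i = (a, d)" "a \<in> box n" "d \<in> box n" by auto
    have "\<bar>a * d - 1\<bar> \<le> 20 * (int n)\<^sup>2"
      using mult_abs_le_square[OF i(2,3)] n_le_square n by linarith
    then show "\<bar>?g i\<bar> \<le> 20 * (int n)\<^sup>2" by (simp add: i(1))
  qed (use K1 in auto)
  also have "\<dots> \<le> K * (3 * real n * (3 * real n)) + 6 * real n * 4"
  proof (intro add_mono mult_left_mono)
    show "real (card ?I) \<le> 3 * real n * (3 * real n)"
      unfolding card_cartesian_product of_nat_mult using card_box_le[OF n] by (intro mult_mono) auto
    have "{i \<in> ?I. ?g i = 0} \<subseteq> {1, -1} \<times> {1, -1}" by (auto simp: zmult_eq_1_iff)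
    then have "card {i \<in> ?I. ?g i = 0} \<le> card ({1, -1 :: int} \<times> {1, -1 :: int})"
      by (intro card_mono) auto
    then show "real (card {i \<in> ?I. ?g i = 0}) \<le> 4" by (simp add: card_cartesian_product)
  qed (use K1 in auto)
  also have "\<dots> \<le> 33 * K * (real n)\<^sup>2"
  proof -
    have "real n \<le> K * (real n)\<^sup>2"
      using mult_mono[of 1 K "real n" "(real n)\<^sup>2"] n K1 by (simp add: power2_eq_square)
    then show ?thesis by (simp add: power2_eq_square)
  qed
  finally show ?thesis .
qed

text \<open>The fixed unknowns are the upper left entry and the trace, which has 19 values. The
  product vanishes only for a = 1 or a = -1: 285 = 57 + 228.\<close>

lemma card_small_trace_le:
  "real (card {A \<in> SL2Z_ball X. \<bar>A $ 1 $ 1 + A $ 2 $ 2\<bar> \<le> 9}) \<le> 285 * K * real n"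
    (is "real (card ?T) \<le> _")
proof -
  let ?g = "\<lambda>(a, t). a * (t - a) - 1 :: int"
  let ?I = "box n \<times> {-9..9 :: int}"
  have "card ?T \<le> card (SIGMA i:?I. fac n (?g i))"
  proof (rule card_inj_on_le)
    show "inj_on (\<lambda>A. ((A $ 1 $ 1, A $ 1 $ 1 + A $ 2 $ 2), (A $ 1 $ 2, A $ 2 $ 1))) ?T"
      by (rule inj_onI) (simp add: vec2_eq_iff)
    show "(\<lambda>A. ((A $ 1 $ 1, A $ 1 $ 1 + A $ 2 $ 2), (A $ 1 $ 2, A $ 2 $ 1))) ` ?T
        \<subseteq> (SIGMA i:?I. fac n (?g i))"
      using SL2Z_ballD(2) SL2Z_ball_off_diagonal unfolding nX by (auto simp: fac_def)
  qed (intro finite_SigmaI; simp)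
  then have "real (card ?T) \<le> real (card (SIGMA i:?I. fac n (?g i)))" by (simp only: of_nat_le_iff)
  also have "\<dots> \<le> K * real (card ?I) + 6 * real n * real (card {i \<in> ?I. ?g i = 0})"
  proof (rule card_Sigma_fac_le[OF _ n _ K])
    fix i assume "i \<in> ?I"
    then obtain a t where i: "i = (a, t)" "a \<in> box n" "\<bar>t\<bar> \<le> 9" by auto
    have "\<bar>a * t\<bar> \<le> int n * 9"
      unfolding abs_mult using i by (intro mult_mono) (auto simp: box_def)
    then have "\<bar>a * t - a * a - 1\<bar> \<le> 20 * (int n)\<^sup>2"
      using mult_abs_le_square[OF i(2) i(2)] n_le_square n by linarith
    then show "\<bar>?g i\<bar> \<le> 20 * (int n)\<^sup>2" by (simp add: i(1) algebra_simps)
  qed (use K1 in auto)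
  also have "\<dots> \<le> K * (3 * real n * 19) + 6 * real n * 38"
  proof (intro add_mono mult_left_mono)
    show "real (card ?I) \<le> 3 * real n * 19"
      unfolding card_cartesian_product of_nat_mult using card_box_le[OF n] by (intro mult_mono) auto
    have "{i \<in> ?I. ?g i = 0} \<subseteq> {1, -1} \<times> {-9..9}" by (auto simp: zmult_eq_1_iff)
    then have "card {i \<in> ?I. ?g i = 0} \<le> card ({1, -1 :: int} \<times> {-9..9 :: int})"
      by (intro card_mono) auto
    then show "real (card {i \<in> ?I. ?g i = 0}) \<le> 38" by (simp add: card_cartesian_product)
  qed (use K1 in auto)
  also have "\<dots> \<le> 285 * K * real n"
    using mult_right_mono[OF K1, of "real n"] by simp
  finally show ?thesis .
qed

text \<open>The fixed unknowns are \<open>p $ 1\<close>, \<open>v $ 2\<close> and the wedge k, which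
  leaves a known product of \<open>p $ 2\<close> and \<open>v $ 1\<close>. It vanishes only when k
  is the product of the other two: 135 = 81 + 54.\<close>

lemma near_pairs_le: "finite (near_pairs n)" "real (card (near_pairs n)) \<le> 135 * K * real n ^ 3"
proof -
  let ?g = "\<lambda>(x, y, k). x * y - k :: int"
  let ?J = "{- (4 * int n)..4 * int n}"
  let ?I = "box n \<times> box n \<times> ?J"
  let ?f = "\<lambda>(p, v). ((p $ 1, v $ 2, wedge p v), (p $ 2, v $ 1))"
  have inj: "inj_on ?f (near_pairs n)"
    by (rule inj_onI) (auto simp: vec2_eq_iff)
  have sub: "?f ` near_pairs n \<subseteq> (SIGMA i:?I. fac n (?g i))"
    by (auto simp: near_pairs_def fac_def vheight_def wedge_def abs_le_iff_box)
  have fin: "finite (SIGMA i:?I. fac n (?g i))" by (intro finite_SigmaI; simp)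
  show "finite (near_pairs n)" by (rule inj_on_finite[OF inj sub fin])
  have "real (card (near_pairs n)) \<le> real (card (SIGMA i:?I. fac n (?g i)))"
    using card_inj_on_le[OF inj sub fin] by (simp only: of_nat_le_iff)
  also have "\<dots> \<le> K * real (card ?I) + 6 * real n * real (card {i \<in> ?I. ?g i = 0})"
  proof (rule card_Sigma_fac_le[OF _ n _ K])
    fix i assume "i \<in> ?I"
    then obtain x y k where i: "i = (x, y, k)" "x \<in> box n" "y \<in> box n" "\<bar>k\<bar> \<le> 4 * int n" by auto
    have "\<bar>x * y - k\<bar> \<le> 20 * (int n)\<^sup>2"
      using mult_abs_le_square[OF i(2) i(3)] n_le_square i(4) by linarith
    then show "\<bar>?g i\<bar> \<le> 20 * (int n)\<^sup>2" by (simp add: i(1))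
  qed (use K1 in auto)
  also have "\<dots> \<le> K * (3 * real n * (3 * real n * (9 * real n))) + 6 * real n * (3 * real n * (3 * real n))"
  proof (intro add_mono mult_left_mono)
    have "real (card ?J) \<le> 9 * real n" using n by simp
    then show "real (card ?I) \<le> 3 * real n * (3 * real n * (9 * real n))"
      unfolding card_cartesian_product of_nat_mult using card_box_le[OF n] by (intro mult_mono) auto
    have "{i \<in> ?I. ?g i = 0} \<subseteq> (\<lambda>(x, y). (x, y, x * y)) ` (box n \<times> box n)" by auto
    then have "card {i \<in> ?I. ?g i = 0} \<le> card (box n \<times> box n)"
      by (intro surj_card_le) auto
    then have "real (card {i \<in> ?I. ?g i = 0}) \<le> real (card (box n)) * real (card (box n))"
      unfolding card_cartesian_product of_nat_mult[symmetric] of_nat_le_iff .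
    also have "\<dots> \<le> 3 * real n * (3 * real n)"
      using card_box_le[OF n] by (intro mult_mono) auto
    finally show "real (card {i \<in> ?I. ?g i = 0}) \<le> 3 * real n * (3 * real n)" .
  qed (use K1 in auto)
  also have "\<dots> \<le> 135 * K * real n ^ 3"
    using mult_right_mono[OF K1, of "real n ^ 3"] by (simp add: power3_eq_cube)
  finally show "real (card (near_pairs n)) \<le> 135 * K * real n ^ 3" .
qed

end

section \<open>Matrices with a given largest column\<close>

text \<open>The solutions of \<open>wedge p u = \<sigma>\<close> differ by multiples t p. Two
  solutions no longer than \<open>p\<close> differ by at most twice its length, so |t| \<le>
  2.\<close>

lemma card_short_complements:
  assumes "\<bar>\<sigma>\<bar> = 1"
  shows "finite {u. wedge p u = \<sigma> \<and> vheight u \<le> vheight p}"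
    "card {u. wedge p u = \<sigma> \<and> vheight u \<le> vheight p} \<le> 5"
proof -
  let ?U = "{u. wedge p u = \<sigma> \<and> vheight u \<le> vheight p}"
  have "\<exists>f :: int \<Rightarrow> int ^ 2. ?U \<subseteq> f ` {-2..2}"
  proof (cases "?U = {}")
    case False
    then obtain v where v: "wedge p v = \<sigma>" "vheight v \<le> vheight p" by auto
    have "p \<noteq> 0" using v assms by (auto simp: wedge_def)
    then have pos: "0 < vheight p" by (auto simp: vheight_def vec2_eq_iff)
    have "u \<in> (\<lambda>t. \<chi> i. v $ i + t * p $ i) ` {-2..2}" if u: "wedge p u = \<sigma>" "vheight u \<le> vheight p" for u
    proof -
      define t where "t = \<sigma> * wedge u v"
      have \<sigma>: "\<sigma> * \<sigma> = 1" using assms by (simp add: abs_if split: if_splits)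
      have ut: "u $ i = v $ i + t * p $ i" for i
      proof -
        have "(u $ i - v $ i) * wedge p v = wedge u v * p $ i + v $ i * (wedge p u - wedge p v)"
          using exhaust_2[of i] by (auto simp: wedge_def algebra_simps)
        then have "\<sigma> * ((u $ i - v $ i) * \<sigma>) = \<sigma> * (wedge u v * p $ i)" using u v by simp
        then have "(\<sigma> * \<sigma>) * (u $ i - v $ i) = t * p $ i" by (simp add: t_def mult_ac)
        then show ?thesis using \<sigma> by simp
      qed
      have "\<bar>t\<bar> * \<bar>p $ i\<bar> \<le> 2 * vheight p" for i
      proof -
        have "\<bar>t\<bar> * \<bar>p $ i\<bar> = \<bar>u $ i - v $ i\<bar>" using ut[of i] by (simp add: abs_mult)
        also have "\<dots> \<le> \<bar>u $ i\<bar> + \<bar>v $ i\<bar>" by linarith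
        also have "\<dots> \<le> 2 * vheight p"
          using u(2) v(2) exhaust_2[of i] by (auto simp: vheight_def)
        finally show ?thesis .
      qed
      from this[of 1] this[of 2] have "\<bar>t\<bar> * vheight p \<le> 2 * vheight p"
        unfolding vheight_def[of p] by (auto simp: max_def)
      then have "\<bar>t\<bar> \<le> 2" using pos by simp
      then show ?thesis using ut by (intro image_eqI[of _ _ t]) (auto simp: vec_eq_iff)
    qed
    then show ?thesis by blast
  qed auto
  then obtain f :: "int \<Rightarrow> int ^ 2" where f: "?U \<subseteq> f ` {-2..2}" by blast
  show "finite ?U" by (rule finite_subset[OF f]) simp
  have "card ?U \<le> card {-2..2 :: int}" by (rule surj_card_le[OF _ f]) simp
  then show "card ?U \<le> 5" by simp
qed

text \<open>The other column is a short complement of \<open>p\<close>, with wedge 1 or -1 according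
  to whether \<open>p\<close> is the first or the second column.\<close>

lemma card_att_fibre:
  "finite {A. det A = 1 \<and> att A = p}" "card {A. det A = 1 \<and> att A = p} \<le> 10"
proof -
  let ?U = "\<lambda>\<sigma>. {u. wedge p u = \<sigma> \<and> vheight u \<le> vheight p}"
  let ?f = "\<lambda>u. if wedge p u = 1
    then vector [vector [p $ 1, u $ 1], vector [p $ 2, u $ 2]] :: int ^ 2 ^ 2
    else vector [vector [u $ 1, p $ 1], vector [u $ 2, p $ 2]]"
  have sub: "{A. det A = 1 \<and> att A = p} \<subseteq> ?f ` (?U 1 \<union> ?U (-1))"
  proof
    fix A :: "int ^ 2 ^ 2" assume "A \<in> {A. det A = 1 \<and> att A = p}"
    then have A: "det A = 1" and p: "p = att A" by auto
    have le: "vheight (column k A) \<le> vheight (att A)" for k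
      using exhaust_2[of k] height_eq_max[of A] by auto
    consider "att A = column 1 A" | "att A = column 2 A" using att_column_cases by blast
    then show "A \<in> ?f ` (?U 1 \<union> ?U (-1))"
    proof cases
      case 1
      have "wedge (column 1 A) (column 2 A) = 1" using A by (simp add: wedge_def column_def det_2 mult.commute)
      then show ?thesis using le[of 2] unfolding p 1
        by (intro image_eqI[of _ _ "column 2 A"]) (auto simp: vec2_eq_iff column_def)
    next
      case 2
      have "wedge (column 2 A) (column 1 A) = -1" using A by (simp add: wedge_def column_def det_2 mult.commute)
      then show ?thesis using le[of 1] unfolding p 2
        by (intro image_eqI[of _ _ "column 1 A"]) (auto simp: vec2_eq_iff column_def)
    qed
  qed
  have fin: "finite (?U 1 \<union> ?U (-1))" using card_short_complements(1) by simp
  show "finite {A. det A = 1 \<and> att A = p}" by (rule finite_surj[OF fin sub])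
  have "card {A. det A = 1 \<and> att A = p} \<le> card (?U 1 \<union> ?U (-1))"
    by (rule surj_card_le[OF fin sub])
  also have "\<dots> \<le> card (?U 1) + card (?U (-1))" by (rule card_Un_le)
  also have "\<dots> \<le> 10" using card_short_complements(2)[of 1 p] card_short_complements(2)[of "-1" p] by simp
  finally show "card {A. det A = 1 \<and> att A = p} \<le> 10" .
qed

lemma card_att_adj2_fibre:
  "finite {A. det A = 1 \<and> (att A = p \<or> att (adj2 A) = p)}"
  "card {A. det A = 1 \<and> (att A = p \<or> att (adj2 A) = p)} \<le> 20"
proof -
  let ?F = "{A. det A = 1 \<and> att A = p}"
  have sub: "{A. det A = 1 \<and> (att A = p \<or> att (adj2 A) = p)} \<subseteq> ?F \<union> adj2 ` ?F"
  proof (rule subsetI)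
    fix A assume A: "A \<in> {A. det A = 1 \<and> (att A = p \<or> att (adj2 A) = p)}"
    then have "A \<in> ?F \<or> adj2 A \<in> ?F" by auto
    then show "A \<in> ?F \<union> adj2 ` ?F"
    proof
      assume "adj2 A \<in> ?F"
      then have "adj2 (adj2 A) \<in> adj2 ` ?F" by (rule imageI)
      then show ?thesis by simp
    qed simp
  qed
  have fin: "finite (?F \<union> adj2 ` ?F)" using card_att_fibre(1) by simp
  show "finite {A. det A = 1 \<and> (att A = p \<or> att (adj2 A) = p)}" by (rule finite_subset[OF sub fin])
  have "card {A. det A = 1 \<and> (att A = p \<or> att (adj2 A) = p)} \<le> card (?F \<union> adj2 ` ?F)"
    by (rule card_mono[OF fin sub])
  also have "\<dots> \<le> card ?F + card ?F"
    by (rule order_trans[OF card_Un_le]) (simp add: card_image_le card_att_fibre(1))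
  also have "\<dots> \<le> 20" using card_att_fibre(2)[of p] by simp
  finally show "card {A. det A = 1 \<and> (att A = p \<or> att (adj2 A) = p)} \<le> 20" .
qed

text \<open>Inverses are allowed on both sides, so the relation concerns entries of a tuple rather
  than signed letters.\<close>

definition near_matrices :: "real \<Rightarrow> ((int ^ 2 ^ 2) \<times> (int ^ 2 ^ 2)) set"
  where "near_matrices X = {(A, B) \<in> SL2Z_ball X \<times> SL2Z_ball X.
    \<exists>A' \<in> {A, adj2 A}. \<exists>B' \<in> {B, adj2 B}. \<bar>wedge (att A') (att B')\<bar> \<le> 4 * int (nat \<lfloor>X\<rfloor>)}"

lemma height_le_nat_floor:
  assumes "A \<in> SL2Z_ball X"
  shows "height A \<le> int (nat \<lfloor>X\<rfloor>)"
  using assms height_pos[of A] by (simp add: SL2Z_ball_def le_floor_iff)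

lemma finite_near_matrices [simp]: "finite (near_matrices X)"
  by (rule finite_subset[of _ "SL2Z_ball X \<times> SL2Z_ball X"])
    (auto simp: near_matrices_def finite_SL2Z_ball)

text \<open>A pair is sent to the directions witnessing its nearness; by
  \<open>card_att_adj2_fibre\<close> each pair of directions arises from at most 20 * 20 pairs of
  matrices.\<close>

lemma card_near_matrices_le:
  assumes fin: "finite (near_pairs (nat \<lfloor>X\<rfloor>))"
  shows "card (near_matrices X) \<le> 400 * card (near_pairs (nat \<lfloor>X\<rfloor>))"
proof -
  let ?n = "nat \<lfloor>X\<rfloor>"
  let ?G = "\<lambda>p. {A. det A = 1 \<and> (att A = p \<or> att (adj2 A) = p)}"
  have "near_matrices X \<subseteq> (\<Union>z \<in> near_pairs ?n. ?G (fst z) \<times> ?G (snd z))"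
  proof clarify
    fix A B assume "(A, B) \<in> near_matrices X"
    then obtain A' B' where h: "A \<in> SL2Z_ball X" "B \<in> SL2Z_ball X" "A' \<in> {A, adj2 A}"
      "B' \<in> {B, adj2 B}" "\<bar>wedge (att A') (att B')\<bar> \<le> 4 * int ?n"
      by (auto simp: near_matrices_def)
    have "height A' = height A" "height B' = height B" using h(3,4) by auto
    then have "(att A', att B') \<in> near_pairs ?n"
      using h(5) height_le_nat_floor[OF h(1)] height_le_nat_floor[OF h(2)] by (simp add: near_pairs_def)
    moreover have "A \<in> ?G (att A')" "B \<in> ?G (att B')" using h(1-4) SL2Z_ballD(1) by auto
    ultimately show "(A, B) \<in> (\<Union>z \<in> near_pairs ?n. ?G (fst z) \<times> ?G (snd z))"
      by (intro UN_I[of "(att A', att B')"]) simp_all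
  qed
  then have "card (near_matrices X) \<le> card (\<Union>z \<in> near_pairs ?n. ?G (fst z) \<times> ?G (snd z))"
    using fin card_att_adj2_fibre(1) by (intro card_mono finite_UN_I finite_cartesian_product)
  also have "\<dots> \<le> (\<Sum>z \<in> near_pairs ?n. card (?G (fst z) \<times> ?G (snd z)))"
    by (rule card_UN_le[OF fin])
  also have "\<dots> \<le> (\<Sum>z \<in> near_pairs ?n. 20 * 20)"
    unfolding card_cartesian_product by (intro sum_mono mult_mono card_att_adj2_fibre(2)) auto
  finally show ?thesis by simp
qed

text \<open>By ping-pong, a non-free tuple has two distinct letters with close attracting
  directions. They belong either to one entry or to two.\<close>

lemma nonfree_cases:
  assumes "As \<in> nonfree_tuples s X"
  shows "(\<exists>i<s. \<bar>As ! i $ 1 $ 1 + As ! i $ 2 $ 2\<bar> \<le> 9) \<or>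
    (\<exists>i j. i < j \<and> j < s \<and> (As ! i, As ! j) \<in> near_matrices X)"
proof -
  have As: "length As = s" "set As \<subseteq> SL2Z_ball X" "\<not> free_tuple SL2Z As"
    using assms by (auto simp: nonfree_tuples_def)
  have "set As \<subseteq> carrier SL2Z" using As(2) by (auto simp: SL2Z_ball_def)
  from free_tuple_of_far[OF this] As(3) obtain x y where
    x: "x \<in> {..<length As} \<times> {1, -1}" and y: "y \<in> {..<length As} \<times> {1, -1}" and "x \<noteq> y"
    and near: "\<bar>wedge (att (letter As x)) (att (letter As y))\<bar>
      \<le> 2 * (height (letter As x) + height (letter As y))"
    by (meson linorder_not_less)
  have ball: "As ! i \<in> SL2Z_ball X" if "i < s" for i
    using As that by (meson nth_mem subsetD)
  have lt: "fst x < s" "fst y < s" using x y As(1) by auto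
  have letter: "letter As z \<in> {As ! fst z, adj2 (As ! fst z)}" for z by (simp add: letter_def)
  have h: "height (letter As z) = height (As ! fst z)" for z by (simp add: letter_def)
  have near': "\<bar>wedge (att (letter As x)) (att (letter As y))\<bar> \<le> 4 * int (nat \<lfloor>X\<rfloor>)"
  proof -
    have "a \<le> m \<Longrightarrow> b \<le> m \<Longrightarrow> 2 * (a + b) \<le> 4 * m" for a b m :: int by simp
    then have "2 * (height (letter As x) + height (letter As y)) \<le> 4 * int (nat \<lfloor>X\<rfloor>)"
      unfolding h using height_le_nat_floor ball lt by blast
    with near show ?thesis by (rule order_trans)
  qed
  consider "fst x = fst y" | "fst x < fst y" | "fst y < fst x" by linarith
  then show ?thesis
  proof cases
    \<comment> \<open>Distinct letters with the same index are inverse to each other and have equal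
      height, so \<open>near\<close> is the hypothesis of \<open>trace_bound\<close>.\<close>
    case 1
    let ?A = "letter As x"
    have "letter As y = adj2 ?A"
      using 1 x y \<open>x \<noteq> y\<close> by (cases x; cases y) (auto simp: letter_def)
    moreover have "det ?A = 1"
      using SL2Z_ballD(1)[OF ball[OF lt(1)]] by (simp add: letter_def)
    ultimately have "\<bar>?A $ 1 $ 1 + ?A $ 2 $ 2\<bar> \<le> 9"
      using near by (intro trace_bound) auto
    then have "\<bar>As ! fst x $ 1 $ 1 + As ! fst x $ 2 $ 2\<bar> \<le> 9"
      by (simp add: letter_def add.commute split: if_splits)
    then show ?thesis using lt by blast
  next
    case 2
    have "(As ! fst x, As ! fst y) \<in> near_matrices X"
      using near' letter ball lt unfolding near_matrices_def by blast
    then show ?thesis using 2 lt by blast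
  next
    case 3
    have "\<bar>wedge (att (letter As y)) (att (letter As x))\<bar> \<le> 4 * int (nat \<lfloor>X\<rfloor>)"
      using near' by (subst wedge_commute) simp
    then have "(As ! fst y, As ! fst x) \<in> near_matrices X"
      using letter ball lt unfolding near_matrices_def by blast
    then show ?thesis using 3 lt by blast
  qed
qed

section \<open>Counting lists with one or two constrained entries\<close>

definition delete_nth :: "nat \<Rightarrow> 'a list \<Rightarrow> 'a list"
  where "delete_nth i xs = take i xs @ drop (Suc i) xs"

lemma length_delete_nth: "i < length xs \<Longrightarrow> length (delete_nth i xs) = length xs - 1"
  by (simp add: delete_nth_def)

lemma set_delete_nth: "set (delete_nth i xs) \<subseteq> set xs"
  by (auto simp: delete_nth_def dest: in_set_takeD in_set_dropD)

lemma nth_delete_nth: "i < j \<Longrightarrow> j < length xs \<Longrightarrow> delete_nth j xs ! i = xs ! i"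
  by (simp add: delete_nth_def nth_append)

lemma delete_nth_inject:
  assumes "length xs = length ys" "i < length xs" "xs ! i = ys ! i" "delete_nth i xs = delete_nth i ys"
  shows "xs = ys"
proof -
  have "take i xs = take i ys \<and> drop (Suc i) xs = drop (Suc i) ys"
    using assms by (simp add: delete_nth_def)
  then show ?thesis using assms(1-3) by (metis id_take_nth_drop)
qed

lemma card_lists_nth_le:
  assumes "finite S" "finite T" "i < s"
  shows "card {xs. length xs = s \<and> set xs \<subseteq> S \<and> xs ! i \<in> T} \<le> card T * card S ^ (s - 1)"
proof -
  let ?A = "{xs. length xs = s \<and> set xs \<subseteq> S \<and> xs ! i \<in> T}"
  let ?L = "{xs. set xs \<subseteq> S \<and> length xs = s - 1}"
  let ?f = "\<lambda>xs. (xs ! i, delete_nth i xs)"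
  have "inj_on ?f ?A"
  proof (rule inj_onI)
    fix xs ys assume "xs \<in> ?A" "ys \<in> ?A" "?f xs = ?f ys"
    then show "xs = ys" by - (rule delete_nth_inject[of _ _ i], use assms in auto)
  qed
  moreover have "?f ` ?A \<subseteq> T \<times> ?L"
  proof (rule image_subsetI)
    fix xs assume "xs \<in> ?A"
    then have h: "length xs = s" "set xs \<subseteq> S" "xs ! i \<in> T" by auto
    show "(xs ! i, delete_nth i xs) \<in> T \<times> ?L"
      using h assms set_delete_nth[of i xs] by (auto simp: length_delete_nth)
  qed
  moreover have "finite (T \<times> ?L)" using assms finite_lists_length_eq by auto
  ultimately have "card ?A \<le> card (T \<times> ?L)" by (rule card_inj_on_le)
  then show ?thesis by (simp add: card_cartesian_product card_lists_length_eq[OF assms(1)])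
qed

lemma card_lists_nth_pair_le:
  assumes "finite S" "finite Q" "i < j" "j < s"
  shows "card {xs. length xs = s \<and> set xs \<subseteq> S \<and> (xs ! i, xs ! j) \<in> Q} \<le> card Q * card S ^ (s - 2)"
proof -
  let ?A = "{xs. length xs = s \<and> set xs \<subseteq> S \<and> (xs ! i, xs ! j) \<in> Q}"
  let ?L = "{xs. set xs \<subseteq> S \<and> length xs = s - 2}"
  \<comment> \<open>The larger index is deleted first, so that position \<open>i\<close> still holds
    the same entry.\<close>
  let ?f = "\<lambda>xs. ((xs ! i, xs ! j), delete_nth i (delete_nth j xs))"
  have "inj_on ?f ?A"
  proof (rule inj_onI)
    fix xs ys assume h: "xs \<in> ?A" "ys \<in> ?A" "?f xs = ?f ys"
    then have "delete_nth j xs = delete_nth j ys"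
      by - (rule delete_nth_inject[of _ _ i], use assms in \<open>auto simp: length_delete_nth nth_delete_nth\<close>)
    then show "xs = ys" by - (rule delete_nth_inject[of _ _ j], use h assms in auto)
  qed
  moreover have "?f ` ?A \<subseteq> Q \<times> ?L"
  proof (rule image_subsetI)
    fix xs assume "xs \<in> ?A"
    then have h: "length xs = s" "set xs \<subseteq> S" "(xs ! i, xs ! j) \<in> Q" by auto
    show "((xs ! i, xs ! j), delete_nth i (delete_nth j xs)) \<in> Q \<times> ?L"
      using h assms set_delete_nth[of j xs] set_delete_nth[of i "delete_nth j xs"]
      by (auto simp: length_delete_nth)
  qed
  moreover have "finite (Q \<times> ?L)" using assms finite_lists_length_eq by auto
  ultimately have "card ?A \<le> card (Q \<times> ?L)" by (rule card_inj_on_le)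
  then show ?thesis by (simp add: card_cartesian_product card_lists_length_eq[OF assms(1)])
qed

section \<open>Assembling the upper bound\<close>

text \<open>A union bound over the position or the pair of positions found by
  \<open>nonfree_cases\<close>. The case s = 1 is separated because there are no pairs then, while
  \<open>s - 2\<close> truncates to 0 and would leave the count of \<open>near_matrices\<close>, for
  which only a bound of order X^(3 + o(1)) is available.\<close>

lemma N_nonfree_le_sum:
  "N_nonfree s X \<le>
    s * (card {A \<in> SL2Z_ball X. \<bar>A $ 1 $ 1 + A $ 2 $ 2\<bar> \<le> 9} * card (SL2Z_ball X) ^ (s - 1)) +
    (if s = 1 then 0 else s\<^sup>2 * (card (near_matrices X) * card (SL2Z_ball X) ^ (s - 2)))"
proof -
  let ?S = "SL2Z_ball X"
  let ?T = "{A \<in> ?S. \<bar>A $ 1 $ 1 + A $ 2 $ 2\<bar> \<le> 9}"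
  let ?P = "{(i, j). i < j \<and> j < s}"
  let ?V = "\<lambda>i. {xs. length xs = s \<and> set xs \<subseteq> ?S \<and> xs ! i \<in> ?T}"
  let ?W = "\<lambda>(i, j). {xs. length xs = s \<and> set xs \<subseteq> ?S \<and> (xs ! i, xs ! j) \<in> near_matrices X}"
  have fin: "finite ?T" using finite_SL2Z_ball by simp
  have finP: "finite ?P" by (rule finite_subset[of _ "{..<s} \<times> {..<s}"]) auto
  have finL: "finite {xs. length xs = s \<and> set xs \<subseteq> ?S}"
    using finite_lists_length_eq[OF finite_SL2Z_ball] by (simp add: conj_commute)
  have "nonfree_tuples s X \<subseteq> (\<Union>i<s. ?V i) \<union> (\<Union>z\<in>?P. ?W z)"
  proof
    fix As assume As: "As \<in> nonfree_tuples s X"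
    then have l: "length As = s" "set As \<subseteq> ?S" by (auto simp: nonfree_tuples_def)
    then have ball: "As ! i \<in> ?S" if "i < s" for i using that by (meson nth_mem subsetD)
    from nonfree_cases[OF As] show "As \<in> (\<Union>i<s. ?V i) \<union> (\<Union>z\<in>?P. ?W z)"
    proof (elim disjE exE conjE)
      fix i assume "i < s" "\<bar>As ! i $ 1 $ 1 + As ! i $ 2 $ 2\<bar> \<le> 9"
      then have "As \<in> ?V i" using l ball by simp
      then show ?thesis using \<open>i < s\<close> by blast
    next
      fix i j assume "i < j" "j < s" "(As ! i, As ! j) \<in> near_matrices X"
      then have "As \<in> ?W (i, j)" "(i, j) \<in> ?P" using l by auto
      then show ?thesis by blast
    qed
  qed
  then have "N_nonfree s X \<le> card ((\<Union>i<s. ?V i) \<union> (\<Union>z\<in>?P. ?W z))"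
    unfolding N_nonfree_def
    by (rule card_mono[rotated], intro finite_subset[OF _ finL]) auto
  also have "\<dots> \<le> (\<Sum>i<s. card (?V i)) + (\<Sum>z\<in>?P. card (?W z))"
    by (intro order_trans[OF card_Un_le] add_mono card_UN_le finP) auto
  also have "\<dots> \<le> (\<Sum>i<s. card ?T * card ?S ^ (s - 1)) + (\<Sum>z\<in>?P. card (near_matrices X) * card ?S ^ (s - 2))"
  proof (intro add_mono sum_mono)
    fix i assume "i \<in> {..<s}"
    then show "card (?V i) \<le> card ?T * card ?S ^ (s - 1)"
      by (intro card_lists_nth_le fin finite_SL2Z_ball) simp
  next
    fix z assume "z \<in> ?P"
    then show "card (?W z) \<le> card (near_matrices X) * card ?S ^ (s - 2)"
      by (auto intro!: card_lists_nth_pair_le finite_SL2Z_ball)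
  qed
  also have "\<dots> = s * (card ?T * card ?S ^ (s - 1)) + card ?P * (card (near_matrices X) * card ?S ^ (s - 2))"
    by simp
  also have "\<dots> \<le> s * (card ?T * card ?S ^ (s - 1))
      + (if s = 1 then 0 else s\<^sup>2 * (card (near_matrices X) * card ?S ^ (s - 2)))"
  proof (cases "s = 1")
    case True
    then have P0: "card ?P = 0" by (auto simp: card_eq_0_iff)
    show ?thesis unfolding P0 using True by simp
  next
    case False
    have "card ?P \<le> card ({..<s} \<times> {..<s})" by (intro card_mono) auto
    then show ?thesis using False by (simp add: card_cartesian_product power2_eq_square)
  qed
  finally show ?thesis .
qed

lemma N_nonfree_le:
  fixes \<epsilon> :: real
  assumes s: "s \<ge> 1" and "\<epsilon> > 0"
  shows "\<exists>C. \<forall>X\<ge>1. real (N_nonfree s X) \<le> C * X powr (2 * real s - 1 + \<epsilon>)"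
proof -
  \<comment> \<open>The factor \<open>X powr \<delta>\<close> enters at most \<open>s\<close> times,
    once for each power of K.\<close>
  define \<delta> where "\<delta> = \<epsilon> / real s"
  have "\<delta> > 0" using assms by (simp add: \<delta>_def)
  then obtain C where C: "C \<ge> 1" "\<And>n m. n \<ge> 1 \<Longrightarrow> m \<noteq> 0 \<Longrightarrow> \<bar>m\<bar> \<le> 20 * (int n)\<^sup>2 \<Longrightarrow>
      real (card (fac n m)) \<le> C * real n powr \<delta>"
    using card_fac_bound[of \<delta>] by blast
  have "real (N_nonfree s X) \<le> (real s + (real s)\<^sup>2) * (54000 * C) ^ s * X powr (2 * real s - 1 + \<epsilon>)"
    if "X \<ge> 1" for X
  proof -
    define n where "n = nat \<lfloor>X\<rfloor>"
    have n: "n \<ge> 1" "real n \<le> X" using that unfolding n_def by linarith+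
    define K where "K = C * X powr \<delta>"
    have K1: "1 \<le> K"
      using C(1) that \<open>\<delta> > 0\<close> by (simp add: K_def ge_one_powr_ge_zero mult_ge1_I)
    have K: "real (card (fac n m)) \<le> K" if "m \<noteq> 0" "\<bar>m\<bar> \<le> 20 * (int n)\<^sup>2" for m
    proof -
      have "C * real n powr \<delta> \<le> K"
        unfolding K_def using C(1) n \<open>\<delta> > 0\<close> by (intro mult_left_mono powr_mono2) auto
      then show ?thesis using C(2)[OF n(1) that] by linarith
    qed
    \<comment> \<open>54000 = 400 * 135 comes from the near pairs and exceeds the constants 33 and
      285 of the other two counts.\<close>
    define c where "c = 54000 * K"
    let ?S = "SL2Z_ball X"
    let ?T = "{A \<in> ?S. \<bar>A $ 1 $ 1 + A $ 2 $ 2\<bar> \<le> 9}"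
    have c1: "1 \<le> c" using K1 by (simp add: c_def)
    have S: "real (card ?S) \<le> c * X ^ 2"
    proof -
      have "real (card ?S) \<le> 33 * K * (real n)\<^sup>2"
        by (rule card_ball_le[OF n(1) n_def K1 K])
      also have "\<dots> \<le> c * X ^ 2"
        unfolding c_def using K1 n by (intro mult_mono power_mono) auto
      finally show ?thesis .
    qed
    have T: "real (card ?T) \<le> c * X"
    proof -
      have "real (card ?T) \<le> 285 * K * real n"
        by (rule card_small_trace_le[OF n(1) n_def K1 K])
      also have "\<dots> \<le> c * X" unfolding c_def using K1 n by (intro mult_mono) auto
      finally show ?thesis .
    qed
    have M: "real (card (near_matrices X)) \<le> c * X ^ 3"
    proof -
      have "real (card (near_matrices X)) \<le> real (400 * card (near_pairs n))"
        unfolding of_nat_le_iff n_def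
        by (rule card_near_matrices_le, fold n_def, rule near_pairs_le(1)[OF n(1) n_def K1 K])
      also have "\<dots> \<le> 400 * (135 * K * real n ^ 3)"
        using near_pairs_le(2)[OF n(1) n_def K1 K] by simp
      also have "\<dots> \<le> c * X ^ 3"
        unfolding c_def using K1 n by (simp add: power_mono)
      finally show ?thesis .
    qed
    have "real (card ?T * card ?S ^ (s - 1)) \<le> (c * X) * (c * X ^ 2) ^ (s - 1)"
      unfolding of_nat_mult of_nat_power
      using S T c1 that by (intro mult_mono power_mono) auto
    also have "\<dots> = c ^ s * X ^ (2 * s - 1)"
      using s by (cases s) (simp_all add: power_mult_distrib power_mult[symmetric])
    finally have 1: "real (card ?T * card ?S ^ (s - 1)) \<le> c ^ s * X ^ (2 * s - 1)" .
    have 2: "real (card (near_matrices X) * card ?S ^ (s - 2)) \<le> c ^ s * X ^ (2 * s - 1)" if ne: "s \<noteq> 1"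
    proof -
      obtain t where t: "s = Suc (Suc t)" using s ne by (cases s; cases "s - 1") auto
      have "real (card (near_matrices X) * card ?S ^ (s - 2)) \<le> (c * X ^ 3) * (c * X ^ 2) ^ t"
        unfolding of_nat_mult of_nat_power t
        using S M c1 \<open>X \<ge> 1\<close> by (auto intro!: mult_mono power_mono)
      also have "\<dots> = c ^ Suc t * X ^ (2 * s - 1)"
      proof -
        have "2 * s - 1 = 3 + 2 * t" by (simp add: t)
        then have "X ^ (2 * s - 1) = X ^ 3 * (X ^ 2) ^ t" by (simp only: power_add power_mult)
        then show ?thesis by (simp add: power_mult_distrib)
      qed
      \<comment> \<open>The pair takes up two entries but only one factor \<open>c\<close>; the
        missing factor is supplied by c \<ge> 1.\<close>
      also have "\<dots> \<le> c ^ s * X ^ (2 * s - 1)"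
        using c1 \<open>X \<ge> 1\<close> by (intro mult_right_mono power_increasing) (auto simp: t)
      finally show ?thesis .
    qed
    have "real (N_nonfree s X) \<le> real (s * (card ?T * card ?S ^ (s - 1)) +
        (if s = 1 then 0 else s\<^sup>2 * (card (near_matrices X) * card ?S ^ (s - 2))))"
      using N_nonfree_le_sum[of s X] by (simp only: of_nat_le_iff)
    also have "\<dots> = real s * real (card ?T * card ?S ^ (s - 1)) +
        (if s = 1 then 0 else (real s)\<^sup>2 * real (card (near_matrices X) * card ?S ^ (s - 2)))"
      by simp
    also have "\<dots> \<le> real s * (c ^ s * X ^ (2 * s - 1)) + (real s)\<^sup>2 * (c ^ s * X ^ (2 * s - 1))"
    proof (intro add_mono mult_left_mono 1)
      show "(if s = 1 then 0 else (real s)\<^sup>2 * real (card (near_matrices X) * card ?S ^ (s - 2)))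
          \<le> (real s)\<^sup>2 * (c ^ s * X ^ (2 * s - 1))"
      proof (cases "s = 1")
        case False
        then show ?thesis using mult_left_mono[OF 2[OF False], of "(real s)\<^sup>2"] by simp
      qed (use c1 that in simp)
    qed simp
    also have "\<dots> = (real s + (real s)\<^sup>2) * (54000 * C) ^ s * (X ^ (2 * s - 1) * (X powr \<delta>) ^ s)"
      by (simp add: c_def K_def power_mult_distrib algebra_simps)
    also have "X ^ (2 * s - 1) * (X powr \<delta>) ^ s = X powr (2 * real s - 1 + \<epsilon>)"
    proof -
      have "(X powr \<delta>) ^ s = X powr \<epsilon>"
        using that s by (simp add: powr_realpow[symmetric] powr_powr \<delta>_def)
      moreover have "X ^ (2 * s - 1) = X powr (2 * real s - 1)"
        using that s by (simp add: powr_realpow[symmetric] of_nat_diff)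
      ultimately show ?thesis by (simp add: powr_add)
    qed
    finally show ?thesis .
  qed
  then show ?thesis by blast
qed

text \<open>Half of \<epsilon> goes into the previous bound, and the other half absorbs its constant
  for large \<open>X\<close>.\<close>

lemma N_nonfree_eventually_le:
  fixes \<epsilon> :: real
  assumes s: "s \<ge> 1" and \<epsilon>: "\<epsilon> > 0"
  shows "\<forall>\<^sub>F X in at_top. real (N_nonfree s X) \<le> X powr (2 * real s - 1 + \<epsilon>)"
proof -
  obtain C where C: "\<And>X. X \<ge> 1 \<Longrightarrow> real (N_nonfree s X) \<le> C * X powr (2 * real s - 1 + \<epsilon> / 2)"
    using N_nonfree_le[OF s, of "\<epsilon> / 2"] \<epsilon> by auto
  have "\<forall>\<^sub>F X::real in at_top. C \<le> X powr (\<epsilon> / 2)"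
    using eventually_ge_at_top[of "max 1 C powr (2 / \<epsilon>)"]
  proof eventually_elim
    case (elim X)
    have "C \<le> (max 1 C powr (2 / \<epsilon>)) powr (\<epsilon> / 2)"
      using \<epsilon> by (simp add: powr_powr)
    also have "\<dots> \<le> X powr (\<epsilon> / 2)"
      using elim \<epsilon> by (intro powr_mono2) auto
    finally show ?case .
  qed
  then show ?thesis
    using eventually_ge_at_top[of 1]
  proof eventually_elim
    case (elim X)
    have "real (N_nonfree s X) \<le> C * X powr (2 * real s - 1 + \<epsilon> / 2)" using elim by (intro C)
    also have "\<dots> \<le> X powr (\<epsilon> / 2) * X powr (2 * real s - 1 + \<epsilon> / 2)"
      using elim by (intro mult_right_mono) auto
    also have "\<dots> = X powr (2 * real s - 1 + \<epsilon>)" by (simp add: powr_add[symmetric] algebra_simps)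
    finally show ?case .
  qed
qed

theorem corollary1p2:
  "\<exists>c\<^sub>0::real. c\<^sub>0 > 0 \<and>
     (\<forall>s::nat. s \<ge> 1 \<longrightarrow> (\<forall>\<epsilon>::real. \<epsilon> > 0 \<longrightarrow>
        (\<forall>\<^sub>F X::real in at_top.
           c\<^sub>0 * X powr (2 * real s - 1) \<le> real (N_nonfree s X) \<and>
           real (N_nonfree s X) \<le> X powr (2 * real s - 1 + \<epsilon>))))"
proof (intro exI[of _ "1 / 16 :: real"] conjI allI impI eventually_conj)
  fix s :: nat and \<epsilon> :: real
  assume "s \<ge> 1" "\<epsilon> > 0"
  then show "\<forall>\<^sub>F X in at_top. 1 / 16 * X powr (2 * real s - 1) \<le> real (N_nonfree s X)"
    using N_nonfree_ge by (intro eventually_mono[OF eventually_ge_at_top[of 16]]) blast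
  show "\<forall>\<^sub>F X in at_top. real (N_nonfree s X) \<le> X powr (2 * real s - 1 + \<epsilon>)"
    using \<open>s \<ge> 1\<close> \<open>\<epsilon> > 0\<close> by (rule N_nonfree_eventually_le)
qed simp

end
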